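(* Fix an integer $k\ge 1$, a real number $q>0$, and let $\sigma = 123\cdots k(k+1)$ be the increasing permutation of $\{1,\dots,k+1\}$. For each $n\geq 1$ let $\Pi_n$ be a random involution of $\{1,\dots,n\}$ avoiding $\sigma$, distributed according to $\mathbb{P}^{q,\sigma}_n$. Let $X^q$ have a binomial distribution with parameters $k$ (number of trials) and $q/(1+q)$ (success probability). Then, as $n\to\infty$, $$\mathrm{fp}(\Pi_{2n}) \to_d X^q_{even}\quad\text{and}\quad \mathrm{fp}(\Pi_{2n-1}) \to_d X^q_{odd}.$$
   Context: Let $[n]=\{1,\dots,n\}$. A permutation $\pi$ of $[n]$ contains a permutation $\sigma$ of $[m]$ if there exist indices $i_1<\dots<i_m$ in $[n]$ such that for all $j<l$ in $[m]$, $\pi(i_j)<\pi(i_l)$ if and only if $\sigma(j)<\sigma(l)$; $\pi$ avoids $\sigma$ if it does not contain $\sigma$. Let $I_n(\sigma)$ be the set of involutions of $[n]$ (permutations $\pi$ with $\pi\circ\pi=\mathrm{id}$) that avoid $\sigma$. For a permutation $\pi$, $\mathrm{fp}(\pi)$ is its number of fixed points. For $q\in(0,\infty)$, $\mathbb{P}^{q,\sigma}_n$ is the probability measure on $I_n(\sigma)$ with $\mathbb{P}^{q,\sigma}_n(\pi)\propto q^{\mathrm{fp}(\pi)}$, i.e. $\mathbb{P}^{q,\sigma}_n(\pi)=q^{\mathrm{fp}(\pi)}/\sum_{\tau\in I_n(\sigma)}q^{\mathrm{fp}(\tau)}$. For a $\mathbb{Z}$-valued random variable $X$, $X_{even}$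 denotes a random variable distributed like $X$ conditioned to be even, and $X_{odd}$ one distributed like $X$ conditioned to be odd. The symbol $\to_d$ denotes convergence in distribution. *)

theory Defs
  imports "HOL-Combinatorics.Permutations" "HOL-Probability.Probability"
begin

text \<open>
  A permutation of \<open>[n]\<close> is a function \<open>nat \<Rightarrow> nat\<close> with \<open>\<pi> permutes {1..n}\<close>; it is the
  identity outside \<open>{1..n}\<close>.
\<close>

definition contains_pattern ::
  "nat \<Rightarrow> (nat \<Rightarrow> nat) \<Rightarrow> nat \<Rightarrow> (nat \<Rightarrow> nat) \<Rightarrow> bool" where
  "contains_pattern n \<pi> m \<sigma> \<longleftrightarrow>
     (\<exists>i. i \<in> {1..m} \<rightarrow> {1..n} \<and> strict_mono_on {1..m} i \<and>
        (\<forall>j\<in>{1..m}. \<forall>l\<in>{1..m}. j < l \<longrightarrow> (\<pi> (i j) < \<pi> (i l) \<longleftrightarrow> \<sigma> j < \<sigma> l)))"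

definition avoiding_involutions :: "nat \<Rightarrow> nat \<Rightarrow> (nat \<Rightarrow> nat) \<Rightarrow> (nat \<Rightarrow> nat) set" where
  "avoiding_involutions n m \<sigma> =
     {\<pi>. \<pi> permutes {1..n} \<and> \<pi> \<circ> \<pi> = id \<and> \<not> contains_pattern n \<pi> m \<sigma>}"

definition fp :: "nat \<Rightarrow> (nat \<Rightarrow> nat) \<Rightarrow> nat" where
  "fp n \<pi> = card {i \<in> {1..n}. \<pi> i = i}"

text \<open>
  A probability measure for \<open>q > 0\<close> whenever the set of avoiding involutions is nonempty;
  otherwise it is the null measure on the empty space.
\<close>

definition involution_measure ::
  "real \<Rightarrow> nat \<Rightarrow> nat \<Rightarrow> (nat \<Rightarrow> nat) \<Rightarrow> (nat \<Rightarrow> nat) measure" where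
  "involution_measure q n m \<sigma> =
     point_measure (avoiding_involutions n m \<sigma>)
       (\<lambda>\<pi>. ennreal (q ^ fp n \<pi> / (\<Sum>\<tau>\<in>avoiding_involutions n m \<sigma>. q ^ fp n \<tau>)))"

end

theory Submission
  imports Defs
begin

text \<open>
  Why the theorem holds.  The Robinson--Schensted correspondence attaches to an involution of
  \<open>[n]\<close> a single standard Young tableau.  Its first row is as long as the longest increasing
  subsequence, so avoiding \<open>1 2 \<dots> (k+1)\<close> means having at most \<open>k\<close> columns; and, by a theorem of
  Schuetzenberger, the number of fixed points is the number of columns of odd length.  Listing for
  each entry the column that contains it turns the tableau into a ballot word over \<open>{1..k}\<close>: in
  every prefix, letter \<open>a\<close> occurs at least as often as letter \<open>a + 1\<close>.  Hence the avoiding involutions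
  with \<open>j\<close> fixed points are equinumerous with the ballot words in which exactly \<open>j\<close> letters occur an
  odd number of times (\<open>involution_word_bij\<close>, \<open>fp_involution_word\<close>).

  What remains is an equidistribution statement.  The set of letters with odd multiplicity in a
  uniformly random ballot word of length \<open>n\<close> is asymptotically uniform among the subsets of
  \<open>{1..k}\<close> whose cardinality has the parity of \<open>n\<close> (\<open>odd_letters_equidistributed\<close>).  So the number of
  avoiding involutions with \<open>j\<close> fixed points is asymptotically proportional to the binomial
  coefficient \<open>k choose j\<close> for all \<open>j\<close> of the parity of \<open>n\<close>, and weighting by \<open>q ^ j\<close> gives the binomial
  distribution with success probability \<open>q / (1 + q)\<close>, conditioned on that parity.

  The bijection is built with Beissinger's version of the correspondence, in which an involution
  grows by one point at a time.  A point \<open>n\<close> linked to an earlier \<open>m\<close> is added by row-inserting \<open>m\<close>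
  into the tableau and writing \<open>n\<close> at the end of the row below the last row that the insertion
  reaches.  On words that record the rows of the entries this becomes a single left-to-right scan
  (\<open>bump\<close>), in which the final letter is simply one more bump.  Points whose partner has not yet
  appeared carry the letter 0, so no relabelling of the remaining points is ever necessary.  Both
  statistics can then be followed through the scan.

  For the equidistribution, let \<open>T n\<close> be the number of ballot words of length \<open>n\<close>.  If all \<open>k\<close> letters
  could be appended to every word, a parity character belonging to a set \<open>S\<close> of letters, summed over
  all words, would be multiplied by \<open>k - 2 * card S\<close> in each step, which is smaller than \<open>k\<close> in
  absolute value unless \<open>S\<close> is empty or everything.  The error is at most the number of forbidden
  extensions, \<open>k * T n - T (n + 1)\<close>.  So everything follows from \<open>T (n + 1) / T n \<longlonglongrightarrow> k\<close>
  (\<open>ballot_ratio\<close>).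

  To prove this limit, cut words of length \<open>k * N\<close> into \<open>N\<close> blocks of length \<open>k\<close>.  The block
  \<open>1 2 \<dots> k\<close> may be inserted anywhere without destroying the ballot property.  Counting such
  insertions bounds \<open>T (k * N) / T (k * (N + 1))\<close> by the mean frequency of this block in ballot
  words.  Among all words a frequency noticeably above \<open>1 / k ^ k\<close> is exponentially rare, and
  \<open>T n\<close> has exponential growth rate \<open>k\<close> (\<open>ballot_words_growth\<close>), so it is rare among ballot words
  too (\<open>neutral_letter_ratio\<close>).
\<close>

section \<open>Lattice words\<close>

text \<open>
  A word over the positive integers records a standard Young tableau by the row (or by the column)
  of each entry; the condition says that every prefix has a partition as content.  The letter 0 is
  never compared with anything, so it can mark positions that carry no entry yet.
\<close>

definition lattice_word :: "nat list \<Rightarrow> bool" where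
  "lattice_word w \<longleftrightarrow>
     (\<forall>u v. w = u @ v \<longrightarrow> (\<forall>a\<ge>1. count_list u (Suc a) \<le> count_list u a))"

lemma lattice_word_Nil [simp]: "lattice_word []"
  by (simp add: lattice_word_def)

lemma lattice_wordD: "lattice_word w \<Longrightarrow> a \<ge> 1 \<Longrightarrow> count_list w (Suc a) \<le> count_list w a"
  unfolding lattice_word_def by (metis append_Nil2)

lemma lattice_word_prefix: "lattice_word (u @ v) \<Longrightarrow> lattice_word u"
  unfolding lattice_word_def by (metis append_assoc)

lemma lattice_word_snoc:
  "lattice_word (w @ [x]) \<longleftrightarrow>
     lattice_word w \<and> (x \<le> 1 \<or> count_list w x < count_list w (x - 1))"
proof
  assume *: "lattice_word (w @ [x])"
  have "x \<le> 1 \<or> count_list w x < count_list w (x - 1)"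
  proof (cases "x \<le> 1")
    case False
    then obtain y where "x = Suc y" "y \<ge> 1" by (cases x) auto
    with lattice_wordD[OF *, of y] show ?thesis by simp
  qed simp
  with * show "lattice_word w \<and> (x \<le> 1 \<or> count_list w x < count_list w (x - 1))"
    using lattice_word_prefix by blast
next
  assume *: "lattice_word w \<and> (x \<le> 1 \<or> count_list w x < count_list w (x - 1))"
  show "lattice_word (w @ [x])"
    unfolding lattice_word_def
  proof (intro allI impI)
    fix u v a assume eq: "w @ [x] = u @ v" and a: "1 \<le> (a::nat)"
    show "count_list u (Suc a) \<le> count_list u a"
    proof (cases v rule: rev_cases)
      case Nil
      then have "u = w @ [x]" using eq by simp
      then show ?thesis using * a lattice_wordD[of w a] by auto
    next
      case (snoc v' y)
      then have "w = u @ v'" using eq by simp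
      then show ?thesis using * a lattice_wordD lattice_word_prefix by blast
    qed
  qed
qed

section \<open>Row insertion on lattice words\<close>

text \<open>
  Row insertion, read on the word of row indices.  Starting in row \<open>c\<close>, the next entry of that row is
  bumped into row \<open>c + 1\<close>, then the next later entry of row \<open>c + 1\<close> is bumped, and so on.  The letter
  appended at the end places the new largest entry in the row below the last one reached.  Applied with
  \<open>c = 0\<close> to a suffix that starts with the letter 0, the scan also fills that open position with a 1; on
  the empty suffix it appends a 1, which is the case of a fixed point.
\<close>

fun bump :: "nat \<Rightarrow> nat list \<Rightarrow> nat list" where
  "bump c [] = [Suc c]"
| "bump c (x # xs) = (if x = c then Suc c # bump (Suc c) xs else x # bump c xs)"

text \<open>
  The two places at which a scan from row 0 may start: an open position, or the end of the word.
\<close>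

definition slot :: "nat list \<Rightarrow> bool" where
  "slot s \<longleftrightarrow> s = [] \<or> hd s = 0"

lemma length_bump [simp]: "length (bump c xs) = Suc (length xs)"
  by (induction xs arbitrary: c) auto

lemma bump_ne [simp]: "bump c s \<noteq> []"
  by (metis length_bump list.size(3) nat.distinct(1))

text \<open>
  While the scan is in row \<open>c\<close>, the part \<open>u'\<close> already written has the content of the part \<open>u\<close> already
  read plus one letter \<open>c\<close>.  This is a partition because row \<open>c - 1\<close> became strictly longer than row
  \<open>c\<close> when the scan entered row \<open>c\<close>, and no letter \<open>c\<close> has been read since.
\<close>

lemma lattice_word_bump_aux:
  assumes "lattice_word (u @ s)" "lattice_word u'" "c \<ge> 1"
    and "\<And>x. x \<ge> 1 \<Longrightarrow> count_list u' x = count_list u x + (if x = c then 1 else 0)"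
    and "c = 1 \<or> count_list u c < count_list u (c - 1)"
  shows "lattice_word (u' @ bump c s)"
  using assms
proof (induction s arbitrary: u u' c)
  case Nil
  then show ?case using lattice_wordD[of u c] by (auto simp: lattice_word_snoc)
next
  case (Cons x s)
  have L: "lattice_word ((u @ [x]) @ s)" using Cons.prems(1) by simp
  have x: "x \<le> 1 \<or> count_list u x < count_list u (x - 1)"
    using lattice_word_prefix[OF L] lattice_word_snoc by blast
  have u: "lattice_word u" using Cons.prems(1) lattice_word_prefix by blast
  show ?case
  proof (cases "x = c")
    case True
    have "lattice_word (u' @ [Suc c])"
      using Cons.prems lattice_wordD[OF u, of c] by (auto simp: lattice_word_snoc)
    moreover have "count_list (u @ [x]) (Suc c) < count_list (u @ [x]) c"
      using lattice_wordD[OF u, of c] Cons.prems(3) True by auto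
    moreover have "count_list (u' @ [Suc c]) y = count_list (u @ [x]) y + (if y = Suc c then 1 else 0)"
      if "y \<ge> 1" for y
      using Cons.prems(4)[OF that] True by auto
    ultimately have "lattice_word ((u' @ [Suc c]) @ bump (Suc c) s)"
      using Cons.IH[OF L, of "u' @ [Suc c]" "Suc c"] Cons.prems(3) by auto
    then show ?thesis using True by simp
  next
    case False
    have "x \<le> 1 \<or> count_list u' x < count_list u' (x - 1)"
    proof (cases "x \<le> 1")
      case False
      then show ?thesis
        using x Cons.prems(4)[of x] Cons.prems(4)[of "x - 1"] \<open>x \<noteq> c\<close> by auto
    qed simp
    then have "lattice_word (u' @ [x])"
      using Cons.prems(2) by (auto simp: lattice_word_snoc)
    moreover have "c = 1 \<or> count_list (u @ [x]) c < count_list (u @ [x]) (c - 1)"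
      using Cons.prems(5) False by auto
    moreover have "count_list (u' @ [x]) y = count_list (u @ [x]) y + (if y = c then 1 else 0)"
      if "y \<ge> 1" for y
      using Cons.prems(4)[OF that] by auto
    ultimately have "lattice_word ((u' @ [x]) @ bump c s)"
      using Cons.IH[OF L, of "u' @ [x]" c] Cons.prems(3) by auto
    then show ?thesis using False by simp
  qed
qed

lemma lattice_word_bump:
  assumes "lattice_word (u @ s)" "slot s"
  shows "lattice_word (u @ bump 0 s)"
proof (cases s)
  case Nil
  then show ?thesis using assms by (simp add: lattice_word_snoc)
next
  case (Cons x s')
  then have s: "s = 0 # s'" using assms by (simp add: slot_def)
  have u: "lattice_word u" using assms lattice_word_prefix by blast
  have "lattice_word ((u @ [1]) @ bump 1 s')"
    by (rule lattice_word_bump_aux[of "u @ [0]"]) (use assms s u in \<open>auto simp: lattice_word_snoc\<close>)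
  then show ?thesis using s by simp
qed

text \<open>
  Going back one row when an insertion is undone: before the last bump, the letter that ended in row
  \<open>c'\<close> was in row \<open>c' - 1\<close>, and the later letters, none of which equals \<open>c'\<close>, were left alone.
\<close>

lemma bump_append:
  assumes "c' \<notin> set t" "c' \<ge> 1" "bump c s = r @ [c']"
  shows "bump c (s @ (c' - 1) # t) = r @ c' # t @ [Suc c']"
  using assms(3)
proof (induction s arbitrary: c r)
  case Nil
  have "bump c' t = t @ [Suc c']" using assms(1) by (induction t) auto
  with Nil show ?case by auto
next
  case (Cons x s)
  obtain y r' where r: "r = y # r'" using Cons.prems by (cases r) (auto split: if_splits)
  then show ?case using Cons r by (auto split: if_splits)
qed

text \<open>
  Every insertion can be undone.  If the last letter of a lattice word is \<open>c + 1\<close> with \<open>c > 0\<close>, a letter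
  \<open>c\<close> must occur before it, and the last such letter is the one that was bumped into row \<open>c\<close> last.
  The prefix that ends there is again a lattice word whose last letter is \<open>c\<close>, which gives the
  induction on \<open>c\<close>.  The statement about contents is what keeps the shortened words lattice words.
\<close>

lemma bump_surj:
  assumes "lattice_word (w @ [Suc c])"
  shows "\<exists>u s. w @ [Suc c] = u @ bump 0 s \<and> slot s \<and> lattice_word (u @ s) \<and>
           (\<forall>x\<ge>1. count_list (w @ [Suc c]) x =
                count_list (u @ s) x + (if x = c then 1 else 0) + (if x = Suc c then 1 else 0))"
  using assms
proof (induction c arbitrary: w)
  case 0
  then show ?case
    by (intro exI[of _ w] exI[of _ "[]"]) (auto simp: slot_def lattice_word_snoc)
next
  case (Suc c)
  define d where "d = Suc c"
  have w: "lattice_word w" and lt: "count_list w (Suc d) < count_list w d"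
    using Suc.prems by (auto simp: lattice_word_snoc d_def)
  have "d \<in> set w"
    using lt by (metis count_notin not_less_zero)
  then obtain w1 w2 where w12: "w = w1 @ d # w2" "d \<notin> set w2"
    by (meson split_list_last)
  have "lattice_word ((w1 @ [d]) @ w2)" using w w12 by simp
  then have w1: "lattice_word (w1 @ [d])" using lattice_word_prefix by blast
  obtain u s where us: "w1 @ [d] = u @ bump 0 s" "slot s" "lattice_word (u @ s)"
    and cnt: "\<And>x. x \<ge> 1 \<Longrightarrow> count_list (w1 @ [d]) x =
                count_list (u @ s) x + (if x = c then 1 else 0) + (if x = d then 1 else 0)"
    using Suc.IH w1 unfolding d_def by blast
  obtain r where r: "bump 0 s = r @ [d]"
    by (metis us(1) length_bump last_appendR last_snoc append_butlast_last_id list.size(3) nat.distinct(1))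
  have w1_eq: "w1 = u @ r" using us(1) r by simp
  \<comment> \<open>The word before the insertion: the last bumped letter goes back to row \<open>c\<close>, and the
    new last letter disappears.\<close>
  define s' where "s' = s @ c # w2"
  have "bump 0 s' = r @ d # w2 @ [Suc d]"
    using bump_append[OF w12(2) _ r] unfolding s'_def d_def by simp
  then have 1: "w @ [Suc d] = u @ bump 0 s'" using w12 w1_eq by simp
  have 2: "slot s'"
  proof (cases s)
    case Nil
    then have "r = []" "d = 1" using r by (auto simp: append_eq_Cons_conv)
    then show ?thesis unfolding s'_def d_def slot_def using Nil by simp
  qed (use us(2) in \<open>auto simp: slot_def s'_def\<close>)
  have cnt1: "count_list (u @ s @ [c]) x = count_list w1 x" if "x \<ge> 1" for x
    using cnt[OF that] by (auto split: if_splits)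
  have 3: "lattice_word (u @ s')"
    unfolding lattice_word_def
  proof (intro allI impI)
    fix u2 v a assume eq: "u @ s' = u2 @ v" and a: "(1::nat) \<le> a"
    have "(u @ s) @ c # w2 = u2 @ v" using eq by (simp add: s'_def)
    then consider t where "u @ s = u2 @ t" | t where "u2 = u @ s @ c # t" "w2 = t @ v"
      unfolding append_eq_append_conv2 by (auto simp: Cons_eq_append_conv)
    then show "count_list u2 (Suc a) \<le> count_list u2 a"
    proof cases
      case 1
      then show ?thesis using us(3) a lattice_word_prefix lattice_wordD by metis
    next
      case 2
      have c2: "count_list u2 x = count_list (w1 @ t) x" if "x \<ge> 1" for x
        using cnt1[OF that] 2 by auto
      have "lattice_word ((w1 @ d # t) @ v)" using w w12 2 by simp
      then have L: "lattice_word (w1 @ d # t)" using lattice_word_prefix by blast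
      show ?thesis
      proof (cases "a = d")
        case True
        have "d \<notin> set t" "d \<notin> set v" using w12 2 by auto
        then have "count_list t d = 0" "count_list v d = 0" by auto
        then have "count_list (w1 @ t) d = count_list w d - 1" "count_list (w1 @ t) (Suc d) \<le> count_list w (Suc d)"
          using w12 2 by auto
        then show ?thesis using c2[of d] c2[of "Suc d"] True lt a by auto
      next
        case False
        then show ?thesis using lattice_wordD[OF L a] c2[of a] c2[of "Suc a"] a by (auto split: if_splits)
      qed
    qed
  qed
  have "count_list (w @ [Suc d]) x =
                count_list (u @ s') x + (if x = d then 1 else 0) + (if x = Suc d then 1 else 0)" if "x \<ge> 1" for x
    using cnt1[OF that] w12 unfolding s'_def by auto
  with 1 2 3 show ?case unfolding d_def by blast
qed

text \<open>
  The inverse scan, run on the reversed word: the first letter \<open>c\<close> met from the right was bumped from row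
  \<open>c - 1\<close>.  The companion \<open>unbump_pos\<close> recovers the position at which the insertion started.
\<close>

fun unbump :: "nat \<Rightarrow> nat list \<Rightarrow> nat list" where
  "unbump 0 ys = ys"
| "unbump (Suc c) [] = []"
| "unbump (Suc c) (y # ys) = (if y = Suc c then c # unbump c ys else y # unbump (Suc c) ys)"

fun unbump_pos :: "nat \<Rightarrow> nat list \<Rightarrow> nat" where
  "unbump_pos 0 ys = length ys"
| "unbump_pos (Suc c) [] = 0"
| "unbump_pos (Suc c) (y # ys) = (if y = Suc c then unbump_pos c ys else unbump_pos (Suc c) ys)"

text \<open>
  Every step of the forward scan is undone by a step of the backward scan.  Letters read in row \<open>a\<close> and
  left unchanged differ from \<open>a\<close>, so the backward scan skips them as well.
\<close>

lemma rev_bump: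
  assumes "a \<ge> 1"
  shows "\<exists>c ys. rev (bump a s) = Suc c # ys \<and>
     (\<forall>zs. unbump c (ys @ zs) = rev s @ unbump a zs \<and> unbump_pos c (ys @ zs) = unbump_pos a zs)"
  using assms
proof (induction s arbitrary: a)
  case Nil
  show ?case by (intro exI[of _ a] exI[of _ "[]"]) auto
next
  case (Cons x s)
  show ?case
  proof (cases "x = a")
    case True
    obtain c ys where *: "rev (bump (Suc a) s) = Suc c # ys"
      "\<And>zs. unbump c (ys @ zs) = rev s @ unbump (Suc a) zs"
      "\<And>zs. unbump_pos c (ys @ zs) = unbump_pos (Suc a) zs"
      using Cons.IH[of "Suc a"] by auto
    show ?thesis
      by (intro exI[of _ c] exI[of _ "ys @ [Suc a]"]) (use * True in auto)
  next
    case False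
    obtain c ys where *: "rev (bump a s) = Suc c # ys"
      "\<And>zs. unbump c (ys @ zs) = rev s @ unbump a zs"
      "\<And>zs. unbump_pos c (ys @ zs) = unbump_pos a zs"
      using Cons.IH[of a] Cons.prems by auto
    obtain a' where a': "a = Suc a'" using Cons.prems by (cases a) auto
    show ?thesis
      by (intro exI[of _ c] exI[of _ "ys @ [x]"]) (use * False a' in auto)
  qed
qed

lemma bump_inverse:
  assumes "slot s"
  shows "\<exists>c ys. rev (u @ bump 0 s) = Suc c # ys \<and> unbump c ys = rev (u @ s) \<and>
           unbump_pos c ys = length u"
proof (cases s)
  case Nil
  then show ?thesis by simp
next
  case (Cons x s')
  then have s: "s = 0 # s'" using assms by (simp add: slot_def)
  obtain c ys where *: "rev (bump 1 s') = Suc c # ys"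
      "\<And>zs. unbump c (ys @ zs) = rev s' @ unbump 1 zs"
      "\<And>zs. unbump_pos c (ys @ zs) = unbump_pos 1 zs"
    using rev_bump[of 1 s'] by auto
  show ?thesis
    by (intro exI[of _ c] exI[of _ "ys @ 1 # rev u"]) (use * s in auto)
qed

lemma bump_inj:
  assumes "u @ bump 0 s = u' @ bump 0 s'" "slot s" "slot s'"
  shows "u = u' \<and> s = s'"
proof -
  have "length u = length u'" "rev (u @ s) = rev (u' @ s')"
    using bump_inverse[OF assms(2), of u] bump_inverse[OF assms(3), of u'] assms(1) by auto
  then show ?thesis by auto
qed

lemma bump_zero_iff:
  "c \<ge> 1 \<Longrightarrow> i < Suc (length s) \<Longrightarrow> bump c s ! i = 0 \<longleftrightarrow> i < length s \<and> s ! i = 0"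
  by (induction s arbitrary: c i) (auto simp: nth_Cons split: nat.splits)

lemma bump_zero_iff0:
  assumes "slot s" "i < Suc (length s)"
  shows "bump 0 s ! i = 0 \<longleftrightarrow> i \<noteq> 0 \<and> i < length s \<and> s ! i = 0"
  using assms bump_zero_iff[of 1 _ "tl s"]
  by (cases s) (auto simp: slot_def nth_Cons split: nat.splits)

section \<open>The lattice word of a partial involution\<close>

text \<open>
  An involution of \<open>{..<n}\<close> in which some points still wait for a partner; these are the points outside
  the domain.
\<close>

definition partial_involution :: "nat \<Rightarrow> (nat \<rightharpoonup> nat) \<Rightarrow> bool" where
  "partial_involution n p \<longleftrightarrow>
     dom p \<subseteq> {..<n} \<and> (\<forall>i j. p i = Some j \<longrightarrow> p j = Some i)"

definition add_pair :: "nat \<Rightarrow> nat \<Rightarrow> (nat \<rightharpoonup> nat) \<Rightarrow> (nat \<rightharpoonup> nat)" where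
  "add_pair m n p = p(m \<mapsto> n, n \<mapsto> m)"

lemma add_pair_apply:
  "add_pair m n p x = (if x = n then Some m else if x = m then Some n else p x)"
  by (simp add: add_pair_def)

lemma partial_involutionD:
  assumes "partial_involution n p" "p i = Some j"
  shows "p j = Some i" "i < n" "j < n"
  using assms unfolding partial_involution_def by blast+

lemma partial_involution_dom: "partial_involution n p \<Longrightarrow> dom p \<subseteq> {..<n}"
  unfolding partial_involution_def by blast

lemma partial_involution_unlinked:
  assumes "partial_involution (Suc n) p" "p n = None"
  shows "partial_involution n p"
proof -
  have "x < n" if "x \<in> dom p" for x
  proof -
    have "x < Suc n" "x \<noteq> n" using partial_involution_dom[OF assms(1)] assms(2) that by auto
    then show ?thesis by simp
  qed
  then show ?thesis using assms(1) unfolding partial_involution_def by blast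
qed

lemma partial_involution_linked:
  assumes "partial_involution (Suc n) p" "p n = Some m"
  obtains q where "partial_involution n q" "m \<le> n" "q m = None" "p = add_pair m n q"
proof
  define q where "q = p(n := None, m := None)"
  have m: "m \<le> n" "p m = Some n"
    using partial_involutionD[OF assms] by auto
  have "i < n" if "q i = Some j" for i j
    using that partial_involutionD(2)[OF assms(1), of i j] unfolding q_def
    by (auto split: if_splits)
  moreover have "q j = Some i" if "q i = Some j" for i j
    using that m assms(2) partial_involutionD(1)[OF assms(1), of i j] unfolding q_def
    by (auto split: if_splits)
  ultimately show "partial_involution n q"
    unfolding partial_involution_def by blast
  show "p = add_pair m n q"
    using m assms(2) by (auto simp: q_def add_pair_apply)
  show "q m = None" "m \<le> n" using m by (simp_all add: q_def)
qed

text \<open>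
  A partial involution is built by adding the points one at a time: a new point stays open, or it is
  linked to an open point or to itself (\<open>m = n\<close>).
\<close>

lemma partial_involution_induct [consumes 1, case_names empty skip link]:
  assumes "partial_involution n p"
    and "P 0 Map.empty"
    and "\<And>n p. partial_involution n p \<Longrightarrow> P n p \<Longrightarrow> P (Suc n) p"
    and "\<And>n p m. partial_involution n p \<Longrightarrow> P n p \<Longrightarrow> m \<le> n \<Longrightarrow> p m = None
           \<Longrightarrow> P (Suc n) (add_pair m n p)"
  shows "P n p"
  using assms(1)
proof (induction n arbitrary: p)
  case 0
  then have "p = Map.empty" using partial_involution_dom by fastforce
  then show ?case using assms(2) by simp
next
  case (Suc n)
  show ?case
  proof (cases "p n")
    case None
    then show ?thesis using assms(3) Suc partial_involution_unlinked by simp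
  next
    case (Some m)
    then obtain q where q: "partial_involution n q" "m \<le> n" "q m = None"
      and p: "p = add_pair m n q"
      using partial_involution_linked[OF Suc.prems] by metis
    show ?thesis
      unfolding p by (rule assms(4)) (use q Suc.IH in simp_all)
  qed
qed

lemma partial_involution_skip: "partial_involution n p \<Longrightarrow> partial_involution (Suc n) p"
  unfolding partial_involution_def lessThan_Suc by (meson subset_insertI2)

lemma partial_involution_outside:
  "partial_involution n p \<Longrightarrow> n \<le> i \<Longrightarrow> p i = None"
  unfolding partial_involution_def using not_less by blast

lemma partial_involution_link:
  assumes "partial_involution n p" "m \<le> n" "p m = None"
  shows "partial_involution (Suc n) (add_pair m n p)"
  unfolding partial_involution_def
proof (intro conjI allI impI)
  show "dom (add_pair m n p) \<subseteq> {..<Suc n}"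
    using partial_involution_dom[OF assms(1)] assms(2) by (force simp: add_pair_apply split: if_splits)
next
  fix i j assume *: "(add_pair m n p) i = Some j"
  have n: "p n = None" using assms partial_involution_outside by blast
  show "(add_pair m n p) j = Some i"
  proof (cases "i = n \<or> i = m")
    case True
    then show ?thesis using * by (auto simp: add_pair_apply split: if_splits)
  next
    case False
    then have "p i = Some j" using * by (simp add: add_pair_apply)
    then have "p j = Some i" by (rule partial_involutionD(1)[OF assms(1)])
    moreover from this have "j \<noteq> n" "j \<noteq> m" using n assms(3) by auto
    ultimately show ?thesis by (simp add: add_pair_apply)
  qed
qed

text \<open>
  The tableau of a partial involution, as the word of row indices.
\<close>

fun word_of :: "nat \<Rightarrow> (nat \<rightharpoonup> nat) \<Rightarrow> nat list" where
  "word_of 0 p = []"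
| "word_of (Suc n) p =
     (case p n of
        None \<Rightarrow> word_of n p @ [0]
      | Some m \<Rightarrow> (let v = word_of n (p(n := None, m := None)) in take m v @ bump 0 (drop m v)))"

lemma word_of_skip:
  "partial_involution n p \<Longrightarrow> word_of (Suc n) p = word_of n p @ [0]"
  by (simp add: partial_involution_outside)

lemma word_of_link:
  assumes "partial_involution n p" "p m = None"
  shows "word_of (Suc n) (add_pair m n p) = take m (word_of n p) @ bump 0 (drop m (word_of n p))"
proof -
  have "(add_pair m n p)(n := None, m := None) = p"
    using assms partial_involution_outside[of n p n] by (auto simp: add_pair_apply)
  then show ?thesis by (simp add: add_pair_apply Let_def)
qed

declare word_of.simps(2) [simp del]

lemma length_word_of:
  "partial_involution n p \<Longrightarrow> length (word_of n p) = n"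
  by (induction rule: partial_involution_induct) (auto simp: word_of_skip word_of_link)

lemma word_of_zero_iff:
  "partial_involution n p \<Longrightarrow> i < n \<Longrightarrow> word_of n p ! i = 0 \<longleftrightarrow> p i = None"
proof (induction arbitrary: i rule: partial_involution_induct)
  case (skip n p)
  then show ?case
    using partial_involution_outside[of n p i]
    by (auto simp: word_of_skip nth_append length_word_of)
next
  case (link n p m)
  have len: "length (word_of n p) = n" using link by (simp add: length_word_of)
  have slot: "slot (drop m (word_of n p))"
    using link len by (cases "m = n") (auto simp: slot_def hd_drop_conv_nth)
  show ?case
  proof (cases "i < m")
    case True
    then have "add_pair m n p i = p i" using link by (simp add: add_pair_apply)
    then show ?thesis using link len True by (simp add: word_of_link nth_append)
  next
    case False
    have "word_of (Suc n) (add_pair m n p) ! i = bump 0 (drop m (word_of n p)) ! (i - m)"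
      using False link len by (auto simp: word_of_link nth_append)
    also have "\<dots> = 0 \<longleftrightarrow> i \<noteq> m \<and> i < n \<and> word_of n p ! i = 0"
      using False link len by (subst bump_zero_iff0[OF slot]) auto
    also have "\<dots> \<longleftrightarrow> add_pair m n p i = None"
      using link.IH[of i] link.prems False partial_involution_outside[OF link.hyps(1), of i]
      by (cases "i < n") (auto simp: add_pair_apply)
    finally show ?thesis .
  qed
qed auto

lemma slot_word_of:
  assumes "partial_involution n p" "m \<le> n" "p m = None"
  shows "slot (drop m (word_of n p))"
  using assms length_word_of[OF assms(1)] word_of_zero_iff[OF assms(1), of m]
  by (cases "m = n") (auto simp: slot_def hd_drop_conv_nth)

lemma lattice_word_of:
  "partial_involution n p \<Longrightarrow> lattice_word (word_of n p)"
proof (induction rule: partial_involution_induct)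
  case (link n p m)
  then show ?case by (simp add: word_of_link lattice_word_bump slot_word_of)
qed (auto simp: word_of_skip lattice_word_snoc)

text \<open>
  The last letter tells whether the last point is open.  If it is linked, undoing the insertion gives
  back its partner and the word of the remaining involution.
\<close>

lemma word_of_inj:
  assumes "partial_involution n p" "partial_involution n q" "word_of n p = word_of n q"
  shows "p = q"
  using assms
proof (induction n arbitrary: p q)
  case 0
  then have "p = Map.empty" "q = Map.empty" using partial_involution_dom by fastforce+
  then show ?case by simp
next
  case (Suc n)
  have last0: "last (word_of (Suc n) r) = 0 \<longleftrightarrow> r n = None"
    if "partial_involution (Suc n) r" for r
    using that length_word_of[OF that] word_of_zero_iff[OF that, of n]
    by (metis diff_Suc_1 last_conv_nth lessI list.size(3) nat.distinct(1))
  show ?case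
  proof (cases "p n")
    case None
    then have "q n = None" using last0 Suc.prems by metis
    with None have "partial_involution n p" "partial_involution n q"
      using Suc.prems partial_involution_unlinked by simp_all
    then show ?thesis using Suc.IH Suc.prems(3) by (simp add: word_of_skip)
  next
    case (Some m)
    then have "q n \<noteq> None" using last0 Suc.prems by (metis option.distinct(1))
    then obtain m' where m': "q n = Some m'" by blast
    obtain p' where p: "partial_involution n p'" "m \<le> n" "p' m = None" "p = add_pair m n p'"
      using partial_involution_linked[OF Suc.prems(1) Some] by metis
    obtain q' where q: "partial_involution n q'" "m' \<le> n" "q' m' = None" "q = add_pair m' n q'"
      using partial_involution_linked[OF Suc.prems(2) m'] by metis
    have "take m (word_of n p') @ bump 0 (drop m (word_of n p')) =
          take m' (word_of n q') @ bump 0 (drop m' (word_of n q'))"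
      using Suc.prems(3) word_of_link[OF p(1,3)] word_of_link[OF q(1,3)] unfolding p(4) q(4) by simp
    then have eq: "take m (word_of n p') = take m' (word_of n q')" "drop m (word_of n p') = drop m' (word_of n q')"
      using bump_inj slot_word_of p(1-3) q(1-3) by blast+
    have "length (take m (word_of n p')) = m" "length (take m' (word_of n q')) = m'"
      using p q length_word_of by simp_all
    then have "m = m'" using eq by simp
    moreover have "word_of n p' = word_of n q'" using eq by (metis append_take_drop_id)
    then have "p' = q'" using Suc.IH p(1) q(1) by blast
    ultimately show ?thesis using p(4) q(4) by simp
  qed
qed

lemma word_of_surj:
  assumes "lattice_word v"
  shows "\<exists>p. partial_involution (length v) p \<and> word_of (length v) p = v"
  using assms
proof (induction "length v" arbitrary: v)
  case 0
  then show ?case by (intro exI[of _ Map.empty]) (simp add: partial_involution_def)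
next
  case (Suc n)
  obtain w x where v: "v = w @ [x]" using Suc.hyps(2) by (cases v rule: rev_cases) auto
  show ?case
  proof (cases x)
    case 0
    have "lattice_word w" "length w = n" using Suc v lattice_word_prefix by auto
    then obtain p where "partial_involution n p" "word_of n p = w"
      using Suc.hyps(1)[of w] by auto
    then have "partial_involution (Suc n) p" "word_of (Suc n) p = v"
      using 0 v word_of_skip partial_involution_skip by simp_all
    then show ?thesis using Suc.hyps(2) by auto
  next
    case (Suc c)
    obtain u s where us: "v = u @ bump 0 s" "slot s" "lattice_word (u @ s)"
      using bump_surj[of w c] Suc Suc.prems v by blast
    have len: "length (u @ s) = n" using us(1) Suc.hyps(2) by simp
    obtain p where p: "partial_involution n p" "word_of n p = u @ s"
      using Suc.hyps(1)[of "u @ s"] len us(3) by auto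
    have m: "length u \<le> n" using len by simp
    have "p (length u) = None"
    proof (cases s)
      case Nil
      then show ?thesis using p len by (auto intro: partial_involution_outside)
    next
      case (Cons y s')
      then show ?thesis using word_of_zero_iff[OF p(1), of "length u"] p us(2) len
        by (auto simp: slot_def nth_append)
    qed
    then have "partial_involution (Suc n) (add_pair (length u) n p)"
      "word_of (Suc n) (add_pair (length u) n p) = v"
      using p m us partial_involution_link word_of_link by simp_all
    then show ?thesis using Suc.hyps(2) by auto
  qed
qed

section \<open>Fixed points\<close>

text \<open>
  The contribution of an entry to the number of odd columns of a tableau, in terms of its row: an entry
  in an odd row completes a column of odd length, an entry in an even row makes a column even again.
\<close>

definition parity_sign :: "nat \<Rightarrow> int" where
  "parity_sign x = (if x = 0 then 0 else if odd x then 1 else - 1)"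

text \<open>
  Each bump moves a letter to the adjacent row, so the signs telescope; the letter appended at the end
  cancels the last bump.
\<close>

lemma sum_parity_sign_bump:
  "c \<ge> 1 \<Longrightarrow> sum_list (map parity_sign (bump c s)) = sum_list (map parity_sign s) - parity_sign c"
proof (induction s arbitrary: c)
  case (Cons x s)
  then show ?case by (auto simp: parity_sign_def)
qed (auto simp: parity_sign_def)

lemma fixed_points_word_of:
  "partial_involution n p \<Longrightarrow>
     int (card {i. p i = Some i}) = sum_list (map parity_sign (word_of n p))"
proof (induction rule: partial_involution_induct)
  case (skip n p)
  then show ?case by (simp add: word_of_skip parity_sign_def)
next
  case (link n p m)
  have n: "p n = None" using link partial_involution_outside by blast
  have v: "sum_list (map parity_sign (word_of n p)) =
      sum_list (map parity_sign (take m (word_of n p))) + sum_list (map parity_sign (drop m (word_of n p)))"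
    by (metis append_take_drop_id map_append sum_list_append)
  show ?case
  proof (cases "m = n")
    case True
    have "{i. (add_pair m n p) i = Some i} = insert n {i. p i = Some i}" using True by (auto simp: add_pair_apply)
    moreover have "finite {i. p i = Some i}"
      by (rule finite_subset[of _ "{..<n}"]) (use partial_involution_dom[OF link.hyps(1)] in auto)
    ultimately show ?thesis
      using link True n by (simp add: word_of_link length_word_of parity_sign_def)
  next
    case False
    then have "{i. (add_pair m n p) i = Some i} = {i. p i = Some i}" using n link by (auto simp: add_pair_apply)
    moreover obtain s where s: "drop m (word_of n p) = 0 # s"
      using slot_word_of[of n p m] False link length_word_of[of n p]
      by (cases "drop m (word_of n p)") (auto simp: slot_def)
    ultimately show ?thesis using link v
      by (simp add: word_of_link s sum_parity_sign_bump) (simp add: parity_sign_def)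
  qed
qed simp

section \<open>Increasing subsequences\<close>

text \<open>
  An increasing subsequence of length \<open>s\<close> among the points with values below \<open>j\<close>.  The bound on the
  values makes the statement about first rows inductive.
\<close>

definition has_chain :: "(nat \<rightharpoonup> nat) \<Rightarrow> nat \<Rightarrow> nat \<Rightarrow> bool" where
  "has_chain p j s \<longleftrightarrow>
     (\<exists>X. finite X \<and> card X = s \<and> (\<forall>x\<in>X. \<exists>y<j. p x = Some y) \<and>
        (\<forall>x\<in>X. \<forall>x'\<in>X. x < x' \<longrightarrow> the (p x) < the (p x')))"

lemma count_one_bump_ge2:
  "c \<ge> 2 \<Longrightarrow> count_list (take i (bump c s)) 1 = count_list (take i s) 1"
proof (induction s arbitrary: i c)
  case Nil
  then show ?case by (cases i) auto
next
  case (Cons x s)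
  then show ?case by (cases i) auto
qed

lemma count_one_bump_1:
  "count_list (take i (bump 1 s)) 1 = count_list (take i s) 1 - 1"
proof (induction s arbitrary: i)
  case Nil
  then show ?case by (cases i) auto
next
  case (Cons x s)
  then show ?case by (cases i) (auto simp: count_one_bump_ge2[simplified])
qed

text \<open>
  Inserting at position \<open>m\<close> adds a letter 1 there and removes the next one to the right, if any.
\<close>

lemma count_one_insert:
  assumes "slot (drop m v)" "m \<le> length v" "m < j"
  shows "count_list (take j (take m v @ bump 0 (drop m v))) 1 =
           max (count_list (take j v) 1) (Suc (count_list (take m v) 1))"
proof -
  obtain i where i: "j - m = Suc i" using assms(3) by (cases "j - m") auto
  have "take j v = take m v @ take (j - m) (drop m v)"
    using assms(3) by (metis le_add_diff_inverse less_imp_le take_add)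
  then have v: "count_list (take j v) 1 = count_list (take m v) 1 + count_list (take (Suc i) (drop m v)) 1"
    using i by simp
  have "count_list (take (Suc i) (bump 0 (drop m v))) 1 = max 1 (count_list (take (Suc i) (drop m v)) 1)"
  proof (cases "drop m v")
    case (Cons x s)
    then have "drop m v = 0 # s" using assms(1) by (simp add: slot_def)
    then show ?thesis by (auto simp: count_one_bump_1[simplified])
  qed simp
  then show ?thesis using assms v i by (simp add: min_absorb2)
qed

lemma has_chain_0: "has_chain p j 0"
  unfolding has_chain_def by (intro exI[of _ "{}"]) auto

lemma has_chain_mono:
  assumes "has_chain p i s" "i \<le> j"
  shows "has_chain p j s"
proof -
  obtain X where X: "finite X" "card X = s" "\<forall>x\<in>X. \<exists>y<i. p x = Some y"
    "\<forall>x\<in>X. \<forall>x'\<in>X. x < x' \<longrightarrow> the (p x) < the (p x')"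
    using assms(1) unfolding has_chain_def by (elim exE conjE)
  have "\<forall>x\<in>X. \<exists>y<j. p x = Some y"
    using X(3) assms(2) order_less_le_trans by blast
  then show ?thesis unfolding has_chain_def using X by (intro exI[of _ X]) simp
qed

lemma has_chain_cong:
  assumes "\<And>x y. y < j \<Longrightarrow> p x = Some y \<longleftrightarrow> q x = Some y"
  shows "has_chain p j s \<longleftrightarrow> has_chain q j s"
proof -
  have *: "has_chain q j s" if "has_chain p j s" and "\<And>x y. y < j \<Longrightarrow> p x = Some y \<longleftrightarrow> q x = Some y" for p q
  proof -
    obtain X where X: "finite X" "card X = s" "\<And>x. x \<in> X \<Longrightarrow> \<exists>y<j. p x = Some y"
      "\<And>x x'. x \<in> X \<Longrightarrow> x' \<in> X \<Longrightarrow> x < x' \<Longrightarrow> the (p x) < the (p x')"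
      using \<open>has_chain p j s\<close> unfolding has_chain_def by blast
    have "q x = p x" if "x \<in> X" for x using X(3)[OF that] \<open>\<And>x y. y < j \<Longrightarrow> p x = Some y \<longleftrightarrow> q x = Some y\<close> by force
    then show ?thesis unfolding has_chain_def using X by (intro exI[of _ X]) auto
  qed
  show ?thesis using *[of p q] *[of q p] assms by blast
qed

lemma has_chain_full:
  assumes "partial_involution n p"
  shows "has_chain p (Suc n) s \<longleftrightarrow> has_chain p n s"
proof
  assume "has_chain p (Suc n) s"
  then show "has_chain p n s"
    unfolding has_chain_def using partial_involutionD(3)[OF assms] by metis
qed (auto intro: has_chain_mono)

text \<open>
  As long as the value \<open>n\<close> is out of range, the only new point is \<open>(n, m)\<close>.  It is the rightmost point,
  so it can only end a chain, and the rest of that chain has values below \<open>m\<close>.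
\<close>

lemma has_chain_insert:
  assumes p: "partial_involution n p" and m: "m \<le> n" "p m = None" and j: "m < j" "j \<le> n \<or> m = n"
  shows "has_chain (add_pair m n p) j s \<longleftrightarrow>
           has_chain p j s \<or> (\<exists>t. s = Suc t \<and> has_chain p m t)"
proof
  let ?q = "add_pair m n p"
  assume "has_chain ?q j s"
  then obtain X where X: "finite X" "card X = s" "\<And>x. x \<in> X \<Longrightarrow> \<exists>y<j. ?q x = Some y"
      "\<And>x x'. x \<in> X \<Longrightarrow> x' \<in> X \<Longrightarrow> x < x' \<Longrightarrow> the (?q x) < the (?q x')"
    unfolding has_chain_def by blast
  have q: "?q x = p x" if "x \<in> X" "x \<noteq> n" for x
    using X(3)[OF that(1)] that j by (auto simp: add_pair_apply split: if_splits)
  show "has_chain p j s \<or> (\<exists>t. s = Suc t \<and> has_chain p m t)"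
  proof (cases "n \<in> X")
    case True
    have "\<exists>y<m. p x = Some y" if "x \<in> X - {n}" for x
    proof -
      have "x \<in> X" "x \<noteq> n" using that by auto
      then obtain y where y: "p x = Some y" using X(3)[of x] q[of x] by metis
      then have "x < n" using p partial_involutionD by blast
      then have "y < m" using X(4)[of x n] that True y q[of x] by (auto simp: add_pair_apply)
      with y show ?thesis by blast
    qed
    moreover have "the (p x) < the (p x')" if "x \<in> X - {n}" "x' \<in> X - {n}" "x < x'" for x x'
      using X(4)[of x x'] that q by auto
    ultimately have "has_chain p m (s - 1)"
      unfolding has_chain_def using X(1,2) True by (intro exI[of _ "X - {n}"]) auto
    moreover have "s \<noteq> 0" using X(1,2) True by (metis card_0_eq empty_iff)
    ultimately show ?thesis by (intro disjI2 exI[of _ "s - 1"]) auto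
  next
    case False
    then have "has_chain p j s"
      unfolding has_chain_def using X q by (intro exI[of _ X]) (metis (no_types, lifting))
    then show ?thesis ..
  qed
next
  let ?q = "add_pair m n p"
  have n: "p n = None" using p partial_involution_outside by blast
  assume "has_chain p j s \<or> (\<exists>t. s = Suc t \<and> has_chain p m t)"
  then show "has_chain ?q j s"
  proof (elim disjE exE conjE)
    assume "has_chain p j s"
    then obtain X where X: "finite X" "card X = s" "\<And>x. x \<in> X \<Longrightarrow> \<exists>y<j. p x = Some y"
      "\<And>x x'. x \<in> X \<Longrightarrow> x' \<in> X \<Longrightarrow> x < x' \<Longrightarrow> the (p x) < the (p x')"
      unfolding has_chain_def by blast
    have "?q x = p x" if "x \<in> X" for x using X(3)[OF that] m n by (auto simp: add_pair_apply)
    then show ?thesis unfolding has_chain_def using X by (intro exI[of _ X]) auto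
  next
    fix t assume s: "s = Suc t" and "has_chain p m t"
    then obtain X where X: "finite X" "card X = t" "\<And>x. x \<in> X \<Longrightarrow> \<exists>y<m. p x = Some y"
      "\<And>x x'. x \<in> X \<Longrightarrow> x' \<in> X \<Longrightarrow> x < x' \<Longrightarrow> the (p x) < the (p x')"
      unfolding has_chain_def by blast
    have q: "?q x = p x" if "x \<in> X" for x using X(3)[OF that] m n by (auto simp: add_pair_apply)
    have lt: "x < n" if "x \<in> X" for x using X(3)[OF that] p partial_involutionD by blast
    have "card (insert n X) = s" using X s lt by (subst card_insert_disjoint) auto
    moreover have "\<exists>y<j. ?q x = Some y" if "x \<in> insert n X" for x
    proof (cases "x = n")
      case False
      then have x: "x \<in> X" using that by simp
      then show ?thesis using X(3)[OF x] q[OF x] j by (metis order.strict_trans)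
    qed (use j in \<open>auto simp: add_pair_apply\<close>)
    moreover have "the (?q x) < the (?q x')" if "x \<in> insert n X" "x' \<in> insert n X" "x < x'" for x x'
    proof (cases "x' = n")
      case True
      then have x: "x \<in> X" using that by auto
      then show ?thesis using X(3)[OF x] q[OF x] True by (auto simp: add_pair_apply)
    next
      case False
      then have x': "x' \<in> X" using that by auto
      then have "x \<in> X" using that lt[OF x'] by auto
      then show ?thesis using X(4) x' q that(3) by metis
    qed
    ultimately show ?thesis unfolding has_chain_def using X(1)
      by (intro exI[of _ "insert n X"]) blast
  qed
qed

text \<open>
  The point \<open>(m, n)\<close> never makes chains longer.  A chain through it continues, to the left, with points
  in positions below \<open>m\<close>.  Reflecting these in the diagonal gives points with values below \<open>m\<close>, and the
  reflected point \<open>(n, m)\<close> extends them to a chain of the same length that avoids the value \<open>n\<close>.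
\<close>

lemma has_chain_top:
  assumes p: "partial_involution n p" and m: "m < n" "p m = None"
  shows "has_chain (add_pair m n p) (Suc n) s \<longleftrightarrow> has_chain (add_pair m n p) n s"
proof
  let ?q = "add_pair m n p"
  have q: "partial_involution (Suc n) ?q" using assms by (intro partial_involution_link) auto
  assume "has_chain ?q (Suc n) s"
  then obtain X where X: "finite X" "card X = s" "\<And>x. x \<in> X \<Longrightarrow> \<exists>y<Suc n. ?q x = Some y"
      "\<And>x x'. x \<in> X \<Longrightarrow> x' \<in> X \<Longrightarrow> x < x' \<Longrightarrow> the (?q x) < the (?q x')"
    unfolding has_chain_def by blast
  show "has_chain ?q n s"
  proof (cases "m \<in> X")
    case False
    have "\<exists>y<n. ?q x = Some y" if x: "x \<in> X" for x
    proof -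
      obtain y where y: "y < Suc n" "?q x = Some y" using X(3)[OF x] by blast
      have "x \<noteq> m" using x False by auto
      then have "y \<noteq> n" using y m partial_involutionD(1)[OF q y(2)] by (auto simp: add_pair_apply)
      then show ?thesis using y by auto
    qed
    then show ?thesis unfolding has_chain_def using X by blast
  next
    case True
    define f where "f x = the (?q x)" for x
    have f1: "?q x = Some (f x) \<and> f x < Suc n" if x: "x \<in> X" for x
    proof -
      obtain y where "y < Suc n \<and> ?q x = Some y" using X(3)[OF x] by blast
      then show ?thesis unfolding f_def by (metis option.sel)
    qed
    then have f: "?q x = Some (f x)" "?q (f x) = Some x" "f x < Suc n" if "x \<in> X" for x
      using that partial_involutionD(1)[OF q] by blast+
    have fm: "f m = n" using m by (simp add: f_def add_pair_apply)
    have below: "x < m \<and> f x < n" if "x \<in> X - {m}" for x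
    proof -
      have "f x \<noteq> n" using f(2)[of x] that m by (auto simp: add_pair_apply)
      then have "f x < n" using f(3)[of x] that by auto
      moreover have "\<not> m < x" using X(4)[of m x] that True fm \<open>f x < n\<close> by (auto simp: f_def)
      ultimately show ?thesis using that by auto
    qed
    \<comment> \<open>Reflect the points before \<open>(m, n)\<close> and replace that point by its mirror image \<open>(n, m)\<close>.\<close>
    define Y where "Y = insert n (f ` (X - {m}))"
    have "inj_on f (X - {m})" using f(2) by (metis Diff_iff inj_onI option.inject)
    then have "card (f ` (X - {m})) = s - 1" using X True by (simp add: card_image)
    moreover have "n \<notin> f ` (X - {m})" using below by auto
    moreover have "s \<noteq> 0" using X(1,2) True by (metis card_0_eq empty_iff)
    ultimately have cY: "card Y = s" using X(1) by (simp add: Y_def)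
    have "\<exists>y<n. ?q x = Some y" if Y: "x \<in> Y" for x
    proof (cases "x = n")
      case False
      then obtain x' where "x' \<in> X - {m}" "x = f x'" using Y by (auto simp: Y_def)
      then show ?thesis using f(2)[of x'] below[of x'] m by auto
    qed (use m in \<open>auto simp: add_pair_apply\<close>)
    moreover have "the (?q y) < the (?q y')" if y: "y \<in> Y" "y' \<in> Y" "y < y'" for y y'
    proof -
      have "y' \<le> n" using y(2) below unfolding Y_def by (metis imageE insert_iff order_le_less)
      then have "y \<noteq> n" using y(3) by simp
      then obtain x where x: "x \<in> X - {m}" "y = f x" using y by (auto simp: Y_def)
      then have qy: "?q y = Some x" using f by blast
      show ?thesis
      proof (cases "y' = n")
        case True
        then show ?thesis using qy below[OF x(1)] m by (auto simp: add_pair_apply)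
      next
        case False
        then obtain x' where x': "x' \<in> X - {m}" "y' = f x'" using y by (auto simp: Y_def)
        then have "?q y' = Some x'" using f by blast
        moreover have "x < x'"
          using X(4)[of x' x] x x' y(3) unfolding f_def by (metis Diff_iff linorder_neqE_nat order.asym)
        ultimately show ?thesis using qy by simp
      qed
    qed
    ultimately show ?thesis unfolding has_chain_def using cY X(1)
      by (intro exI[of _ Y]) (auto simp: Y_def)
  qed
qed (auto intro: has_chain_mono)

text \<open>
  The first row is as long as the longest increasing subsequence (Schensted), for all initial ranges of
  values at once: the number of first-row entries below \<open>j\<close> and the maximal length of a chain with
  values below \<open>j\<close> change in the same way when a point is added.
\<close>

lemma has_chain_iff_count:
  "partial_involution n p \<Longrightarrow> j \<le> n \<Longrightarrow>
     has_chain p j s \<longleftrightarrow> s \<le> count_list (take j (word_of n p)) 1"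
proof (induction arbitrary: j s rule: partial_involution_induct)
  case empty
  then show ?case by (auto simp: has_chain_def)
next
  case (skip n p)
  then show ?case
    using has_chain_full[OF skip.hyps, of s]
    by (cases "j = Suc n") (auto simp: word_of_skip length_word_of)
next
  case (link n p m)
  let ?q = "add_pair m n p" and ?v = "word_of n p"
  have len: "length ?v = n" using link by (simp add: length_word_of)
  have slot: "slot (drop m ?v)" using link slot_word_of by blast
  have ins: "has_chain ?q j s \<longleftrightarrow> s \<le> count_list (take j (word_of (Suc n) ?q)) 1"
    if j: "m < j" "j \<le> n \<or> m = n" "j \<le> Suc n" for j
  proof -
    have "has_chain p j s \<longleftrightarrow> s \<le> count_list (take j ?v) 1"
    proof (cases "j \<le> n")
      case True
      then show ?thesis using link.IH by blast
    next
      case False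
      then have "j = Suc n" using j(3) by simp
      then show ?thesis using link.IH[of n s] has_chain_full[OF link.hyps(1), of s] len by simp
    qed
    moreover have "has_chain p m t \<longleftrightarrow> t \<le> count_list (take m ?v) 1" for t
      using link.IH[of m t] link.hyps(2) by simp
    ultimately have "has_chain ?q j s \<longleftrightarrow>
        s \<le> max (count_list (take j ?v) 1) (Suc (count_list (take m ?v) 1))"
      using has_chain_insert[OF link.hyps j(1,2), of s]
      by (cases s) (simp_all add: le_max_iff_disj has_chain_0)
    also have "max (count_list (take j ?v) 1) (Suc (count_list (take m ?v) 1)) =
        count_list (take j (word_of (Suc n) ?q)) 1"
      using count_one_insert[OF slot _ j(1)] link.hyps len by (simp add: word_of_link)
    finally show ?thesis .
  qed
  consider "j \<le> m" | "m < j" "j \<le> n \<or> m = n" | "m < n" "j = Suc n"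
    using link.prems link.hyps(2) by linarith
  then show ?case
  proof cases
    case 1
    have "has_chain ?q j s \<longleftrightarrow> has_chain p j s"
      by (rule has_chain_cong) (use 1 link.hyps in \<open>auto simp: add_pair_apply dest: partial_involution_outside\<close>)
    moreover have "has_chain p j s \<longleftrightarrow> s \<le> count_list (take j ?v) 1"
      using link.IH[of j s] 1 link.hyps(2) by simp
    ultimately show ?thesis using link.hyps 1 len by (simp add: word_of_link)
  next
    case 2
    then show ?thesis using ins[of j] link.prems by blast
  next
    case 3
    have "count_list (take (Suc n) (word_of (Suc n) ?q)) 1 = count_list (take n (word_of (Suc n) ?q)) 1"
      using count_one_insert[OF slot, of n] count_one_insert[OF slot, of "Suc n"] 3 link.hyps len
      by (simp add: word_of_link)
    then show ?thesis
      using has_chain_top[OF link.hyps(1), of m s] ins[of n] 3 link.hyps(3) by simp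
  qed
qed

section \<open>Conjugate words\<close>

text \<open>
  The letter at position \<open>t\<close> tells in which row the entry \<open>t\<close> lies; its multiplicity up to that point
  tells in which column.
\<close>

definition conjugate :: "nat list \<Rightarrow> nat list" where
  "conjugate w = map (\<lambda>t. count_list (take (Suc t) w) (w ! t)) [0..<length w]"

lemma conjugate_Nil [simp]: "conjugate [] = []"
  by (simp add: conjugate_def)

lemma conjugate_snoc [simp]: "conjugate (w @ [x]) = conjugate w @ [Suc (count_list w x)]"
proof -
  have "map (\<lambda>t. count_list (take (Suc t) (w @ [x])) ((w @ [x]) ! t)) [0..<length w] =
        map (\<lambda>t. count_list (take (Suc t) w) (w ! t)) [0..<length w]"
    by (rule map_cong) (auto simp: nth_append)
  then show ?thesis by (simp add: conjugate_def)
qed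

lemma length_conjugate [simp]: "length (conjugate w) = length w"
  by (simp add: conjugate_def)

text \<open>
  The row lengths and the column lengths of a diagram are conjugate partitions.
\<close>

lemma conjugate_counts:
  assumes "lattice_word w" "0 \<notin> set w" "1 \<le> i" "1 \<le> j"
  shows "j \<le> count_list w i \<longleftrightarrow> i \<le> count_list (conjugate w) j"
  using assms
proof (induction w arbitrary: i j rule: rev_induct)
  case (snoc x w)
  have w: "lattice_word w" "0 \<notin> set w" and x: "1 \<le> x"
    and lt: "x \<le> 1 \<or> count_list w x < count_list w (x - 1)"
    using snoc.prems by (auto simp: lattice_word_snoc)
  note IH = snoc.IH[OF w]
  have "count_list (conjugate w) (Suc (count_list w x)) = x - 1"
  proof -
    have "\<not> x \<le> count_list (conjugate w) (Suc (count_list w x))"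
      using IH[of x "Suc (count_list w x)"] x by simp
    moreover have "x - 1 \<le> count_list (conjugate w) (Suc (count_list w x))"
    proof (cases "x \<le> 1")
      case False
      then show ?thesis using IH[of "x - 1" "Suc (count_list w x)"] lt by simp
    qed simp
    ultimately show ?thesis by simp
  qed
  then show ?case using IH[of i j] snoc.prems(3,4) x by auto
qed simp

lemma conjugate_counts_snoc:
  assumes "lattice_word (w @ [x])" "0 \<notin> set (w @ [x])"
  shows "count_list (conjugate w) (Suc (count_list w x)) = x - 1"
  using conjugate_counts[OF assms, of x "Suc (count_list w x)"]
    conjugate_counts[of w x "Suc (count_list w x)"] lattice_word_prefix[OF assms(1)] assms(2)
  by (cases x) auto

lemma conjugate_conjugate:
  assumes "lattice_word w" "0 \<notin> set w"
  shows "conjugate (conjugate w) = w"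
  using assms
proof (induction w rule: rev_induct)
  case (snoc x w)
  then have "conjugate (conjugate w) = w" using lattice_word_prefix by auto
  then show ?case
    using conjugate_counts_snoc[OF snoc.prems] snoc.prems(2) by (cases x) auto
qed simp

lemma conjugate_no_zero: "0 \<notin> set (conjugate w)"
  by (induction w rule: rev_induct) auto

lemma lattice_word_conjugate:
  assumes "lattice_word w" "0 \<notin> set w"
  shows "lattice_word (conjugate w)"
  using assms
proof (induction w rule: rev_induct)
  case (snoc x w)
  have w: "lattice_word w" "0 \<notin> set w" and x: "1 \<le> x"
    using snoc.prems by (auto simp: lattice_word_snoc)
  have "count_list (conjugate w) (Suc (count_list w x)) < count_list (conjugate w) (count_list w x)"
    if "count_list w x \<noteq> 0"
    using conjugate_counts[OF w x, of "count_list w x"] conjugate_counts_snoc[OF snoc.prems] that x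
    by auto
  then show ?case using snoc.IH[OF w] by (auto simp: lattice_word_snoc)
qed simp

lemma count_conjugate_pos_iff:
  assumes "lattice_word w" "0 \<notin> set w"
  shows "set (conjugate w) \<subseteq> {1..k} \<longleftrightarrow> count_list w 1 \<le> k"
proof -
  have "j \<in> set (conjugate w) \<longleftrightarrow> j \<le> count_list w 1" if "1 \<le> j" for j
    using conjugate_counts[OF assms, of 1 j] that
    by (metis One_nat_def Suc_le_eq count_notin count_list_0_iff neq0_conv order_refl)
  note mem = this
  show ?thesis
  proof
    assume *: "set (conjugate w) \<subseteq> {1..k}"
    show "count_list w 1 \<le> k"
    proof (cases "count_list w 1 = 0")
      case False
      then have "count_list w 1 \<in> set (conjugate w)" using mem[of "count_list w 1"] by simp
      then show ?thesis using * by auto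
    qed simp
  next
    assume k: "count_list w 1 \<le> k"
    show "set (conjugate w) \<subseteq> {1..k}"
    proof
      fix j assume j: "j \<in> set (conjugate w)"
      then have "j \<noteq> 0" using conjugate_no_zero[of w] by metis
      then have "1 \<le> j" by simp
      then show "j \<in> {1..k}" using mem[of j] j k by simp
    qed
  qed
qed

definition odd_letters :: "nat list \<Rightarrow> nat set" where
  "odd_letters w = {a. odd (count_list w a)}"

lemma finite_odd_letters [simp]: "finite (odd_letters w)"
  by (rule finite_subset[of _ "set w"]) (auto simp: odd_letters_def intro: ccontr)

text \<open>
  A letter \<open>x\<close> in the row word increases the length of some column from \<open>x - 1\<close> to \<open>x\<close>.
\<close>

lemma odd_letters_conjugate:
  assumes "lattice_word w" "0 \<notin> set w"
  shows "int (card (odd_letters (conjugate w))) = sum_list (map parity_sign w)"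
  using assms
proof (induction w rule: rev_induct)
  case (snoc x w)
  have w: "lattice_word w" "0 \<notin> set w" and x: "1 \<le> x"
    using snoc.prems by (auto simp: lattice_word_snoc)
  define y where "y = Suc (count_list w x)"
  have c: "count_list (conjugate w) y = x - 1"
    using conjugate_counts_snoc[OF snoc.prems] by (simp add: y_def)
  have IH: "int (card (odd_letters (conjugate w))) = sum_list (map parity_sign w)"
    using snoc.IH[OF w] .
  show ?case
  proof (cases "odd x")
    case True
    then have "odd_letters (conjugate w @ [y]) = insert y (odd_letters (conjugate w))"
      "y \<notin> odd_letters (conjugate w)"
      using c by (auto simp: odd_letters_def)
    moreover have "parity_sign x = 1" using True x by (auto simp: parity_sign_def)
    ultimately show ?thesis using IH by (simp add: y_def[symmetric])
  next
    case False
    then have "odd_letters (conjugate w) = insert y (odd_letters (conjugate w @ [y]))"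
      "y \<notin> odd_letters (conjugate w @ [y])"
      using c x by (auto simp: odd_letters_def)
    moreover have "parity_sign x = - 1" using False x by (auto simp: parity_sign_def)
    ultimately show ?thesis using IH by (simp add: y_def[symmetric])
  qed
qed (simp add: odd_letters_def)

section \<open>From pattern-avoiding involutions to ballot words\<close>

definition ballot_words :: "nat \<Rightarrow> nat \<Rightarrow> nat list set" where
  "ballot_words k n = {w. length w = n \<and> set w \<subseteq> {1..k} \<and> lattice_word w}"

definition involution_map :: "nat \<Rightarrow> (nat \<Rightarrow> nat) \<Rightarrow> (nat \<rightharpoonup> nat)" where
  "involution_map n \<pi> = (\<lambda>i. if i < n then Some (\<pi> (Suc i) - 1) else None)"

lemma involution_mapD:
  assumes "\<pi> permutes {1..n}" "\<pi> \<circ> \<pi> = id"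
  shows "partial_involution n (involution_map n \<pi>)" "dom (involution_map n \<pi>) = {..<n}"
    and "\<And>i. i < n \<Longrightarrow> \<pi> (Suc i) = Suc (the (involution_map n \<pi> i))"
proof -
  show d: "dom (involution_map n \<pi>) = {..<n}" by (auto simp: involution_map_def split: if_splits)
  have r: "\<pi> (Suc i) \<in> {1..n}" if "i < n" for i
    using permutes_in_image[OF assms(1), of "Suc i"] that by auto
  show "\<pi> (Suc i) = Suc (the (involution_map n \<pi> i))" if "i < n" for i
    using r[OF that] that by (auto simp: involution_map_def)
  have "involution_map n \<pi> j = Some i" if ij: "involution_map n \<pi> i = Some j" for i j
  proof -
    have i: "i < n" and j: "j = \<pi> (Suc i) - 1" using ij by (auto simp: involution_map_def split: if_splits)
    have "Suc j = \<pi> (Suc i)" "j < n" using r[OF i] j by auto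
    moreover have "\<pi> (\<pi> (Suc i)) = Suc i" using assms(2) by (metis comp_apply id_apply)
    ultimately show ?thesis by (simp add: involution_map_def)
  qed
  then show "partial_involution n (involution_map n \<pi>)"
    unfolding partial_involution_def using d by blast
qed

lemma involution_map_inj:
  assumes "\<pi> permutes {1..n}" "\<pi> \<circ> \<pi> = id" "\<rho> permutes {1..n}" "\<rho> \<circ> \<rho> = id"
    and "involution_map n \<pi> = involution_map n \<rho>"
  shows "\<pi> = \<rho>"
proof
  fix x
  show "\<pi> x = \<rho> x"
  proof (cases "x \<in> {1..n}")
    case True
    then obtain i where "x = Suc i" "i < n" by (cases x) auto
    then show ?thesis using involution_mapD(3)[OF assms(1,2)] involution_mapD(3)[OF assms(3,4)] assms(5)
      by simp
  next
    case False
    then show ?thesis using assms(1,3) by (simp add: permutes_not_in)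
  qed
qed

lemma involution_map_surj:
  assumes "partial_involution n p" "dom p = {..<n}"
  shows "\<exists>\<pi>. \<pi> permutes {1..n} \<and> \<pi> \<circ> \<pi> = id \<and> involution_map n \<pi> = p"
proof -
  define \<pi> where "\<pi> x = (if x \<in> {1..n} then Suc (the (p (x - 1))) else x)" for x
  have p: "\<exists>j<n. p i = Some j \<and> p j = Some i" if "i < n" for i
    using that assms partial_involutionD[OF assms(1)] by (metis domD lessThan_iff)
  have inv: "\<pi> (\<pi> x) = x" for x
  proof (cases "x \<in> {1..n}")
    case True
    then obtain i where i: "x = Suc i" "i < n" by (cases x) auto
    then obtain j where j: "j < n" "p i = Some j" "p j = Some i" using p by blast
    then show ?thesis using i by (simp add: \<pi>_def)
  next
    case False
    then have "\<pi> x = x" unfolding \<pi>_def by (rule if_not_P)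
    then show ?thesis by simp
  qed
  have "\<pi> permutes {1..n}"
    unfolding permutes_def
  proof (intro conjI allI impI)
    show "\<exists>!x. \<pi> x = y" for y using inv by metis
  qed (auto simp: \<pi>_def)
  moreover have "\<pi> \<circ> \<pi> = id" using inv by auto
  moreover have "involution_map n \<pi> = p"
  proof
    fix i
    show "involution_map n \<pi> i = p i"
    proof (cases "i < n")
      case True
      then show ?thesis using p[OF True] by (auto simp: involution_map_def \<pi>_def)
    next
      case False
      then show ?thesis using partial_involution_outside[OF assms(1)] by (simp add: involution_map_def)
    qed
  qed
  ultimately show ?thesis by blast
qed

lemma fp_involution_map:
  assumes "\<pi> permutes {1..n}" "\<pi> \<circ> \<pi> = id"
  shows "fp n \<pi> = card {i. involution_map n \<pi> i = Some i}"
proof -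
  have "{i \<in> {1..n}. \<pi> i = i} = Suc ` {i. involution_map n \<pi> i = Some i}"
  proof (intro set_eqI iffI)
    fix x assume x: "x \<in> {i \<in> {1..n}. \<pi> i = i}"
    then obtain i where "x = Suc i" "i < n" by (cases x) auto
    then show "x \<in> Suc ` {i. involution_map n \<pi> i = Some i}"
      using x by (auto simp: involution_map_def)
  next
    fix x assume "x \<in> Suc ` {i. involution_map n \<pi> i = Some i}"
    then obtain i where i: "x = Suc i" "involution_map n \<pi> i = Some i" by blast
    then have "i < n" by (auto simp: involution_map_def split: if_splits)
    then show "x \<in> {i \<in> {1..n}. \<pi> i = i}" using i involution_mapD(3)[OF assms] by simp
  qed
  then show ?thesis by (simp add: fp_def card_image)
qed

text \<open>
  The positions used by an occurrence of the increasing pattern form a chain, and the sorted list of the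
  positions of a chain is such an occurrence.
\<close>

lemma contains_increasing_iff:
  assumes "\<pi> permutes {1..n}" "\<pi> \<circ> \<pi> = id"
  shows "contains_pattern n \<pi> m id \<longleftrightarrow> has_chain (involution_map n \<pi>) n m"
proof
  note D = involution_mapD[OF assms]
  assume "contains_pattern n \<pi> m id"
  then obtain i where i: "i \<in> {1..m} \<rightarrow> {1..n}" "strict_mono_on {1..m} i"
    "\<And>j l. j \<in> {1..m} \<Longrightarrow> l \<in> {1..m} \<Longrightarrow> j < l \<Longrightarrow> \<pi> (i j) < \<pi> (i l)"
    unfolding contains_pattern_def by auto
  define f where "f j = i j - 1" for j
  have f: "f j < n" "i j = Suc (f j)" if "j \<in> {1..m}" for j
    using i(1) that by (auto simp: f_def Pi_iff) force+
  have lt: "f j < f l \<longleftrightarrow> j < l" if "j \<in> {1..m}" "l \<in> {1..m}" for j l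
    using strict_mono_on_less[OF i(2) that] f that by simp
  then have "inj_on f {1..m}" by (metis inj_onI linorder_neqE_nat order_less_irrefl)
  then have "card (f ` {1..m}) = m" by (simp add: card_image)
  moreover have "\<exists>y<n. involution_map n \<pi> x = Some y" if "x \<in> f ` {1..m}" for x
  proof -
    have "x \<in> dom (involution_map n \<pi>)" using that f D(2) by auto
    then show ?thesis using partial_involutionD(3)[OF D(1)] by blast
  qed
  moreover have "the (involution_map n \<pi> x) < the (involution_map n \<pi> x')"
    if xx: "x \<in> f ` {1..m}" "x' \<in> f ` {1..m}" "x < x'" for x x'
  proof -
    obtain j l where "x = f j" "x' = f l" "j \<in> {1..m}" "l \<in> {1..m}" using xx(1,2) by blast
    then show ?thesis using i(3)[of j l] lt xx(3) f D(3) by simp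
  qed
  ultimately show "has_chain (involution_map n \<pi>) n m"
    unfolding has_chain_def by (intro exI[of _ "f ` {1..m}"]) blast
next
  note D = involution_mapD[OF assms]
  assume "has_chain (involution_map n \<pi>) n m"
  then obtain X where X: "finite X" "card X = m" "\<And>x. x \<in> X \<Longrightarrow> \<exists>y<n. involution_map n \<pi> x = Some y"
      "\<And>x x'. x \<in> X \<Longrightarrow> x' \<in> X \<Longrightarrow> x < x' \<Longrightarrow> the (involution_map n \<pi> x) < the (involution_map n \<pi> x')"
    unfolding has_chain_def by blast
  have Xn: "x < n" if "x \<in> X" for x using X(3)[OF that] D(2) by blast
  define e where "e = sorted_list_of_set X"
  have e: "length e = m" "set e = X" "sorted_wrt (<) e" using X by (simp_all add: e_def)
  define i where "i j = Suc (e ! (j - 1))" for j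
  have eX: "e ! (j - 1) \<in> X" if "j \<in> {1..m}" for j
    using that e by (metis One_nat_def Suc_le_eq Suc_pred' atLeastAtMost_iff less_eq_Suc_le nth_mem order_less_le_trans)
  have elt: "e ! (j - 1) < e ! (l - 1)" if "j \<in> {1..m}" "l \<in> {1..m}" "j < l" for j l
    using sorted_wrt_nth_less[OF e(3), of "j - 1" "l - 1"] that e(1) by auto
  have "i \<in> {1..m} \<rightarrow> {1..n}" using eX Xn by (auto simp: i_def Suc_le_eq)
  moreover have "strict_mono_on {1..m} i"
    using elt by (auto simp: i_def strict_mono_on_def)
  moreover have "\<pi> (i j) < \<pi> (i l)" if "j \<in> {1..m}" "l \<in> {1..m}" "j < l" for j l
    using X(4)[OF eX[OF that(1)] eX[OF that(2)] elt[OF that]] D(3) Xn eX that by (simp add: i_def)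
  ultimately show "contains_pattern n \<pi> m id"
    unfolding contains_pattern_def by (intro exI[of _ i]) auto
qed

definition involution_word :: "nat \<Rightarrow> (nat \<Rightarrow> nat) \<Rightarrow> nat list" where
  "involution_word n \<pi> = conjugate (word_of n (involution_map n \<pi>))"

lemma word_of_no_zero_iff:
  assumes "partial_involution n p"
  shows "0 \<notin> set (word_of n p) \<longleftrightarrow> dom p = {..<n}"
proof -
  have "0 \<notin> set (word_of n p) \<longleftrightarrow> (\<forall>i<n. p i \<noteq> None)"
    using word_of_zero_iff[OF assms] length_word_of[OF assms] by (metis in_set_conv_nth)
  also have "\<dots> \<longleftrightarrow> dom p = {..<n}" using partial_involution_dom[OF assms] by blast
  finally show ?thesis .
qed

theorem involution_word_bij:
  "bij_betw (involution_word n) (avoiding_involutions n (k + 1) id) (ballot_words k n)"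
proof (rule bij_betw_imageI)
  let ?A = "avoiding_involutions n (k + 1) id"
  have A: "partial_involution n (involution_map n \<pi>)" "0 \<notin> set (word_of n (involution_map n \<pi>))"
    "\<pi> permutes {1..n}" "\<pi> \<circ> \<pi> = id" if "\<pi> \<in> ?A" for \<pi>
    using that involution_mapD word_of_no_zero_iff unfolding avoiding_involutions_def by auto
  have one: "contains_pattern n \<pi> (k + 1) id \<longleftrightarrow> \<not> set (involution_word n \<pi>) \<subseteq> {1..k}"
    if "\<pi> permutes {1..n}" "\<pi> \<circ> \<pi> = id" for \<pi>
  proof -
    note D = involution_mapD[OF that]
    have "contains_pattern n \<pi> (k + 1) id \<longleftrightarrow> k + 1 \<le> count_list (word_of n (involution_map n \<pi>)) 1"
      using contains_increasing_iff[OF that] has_chain_iff_count[OF D(1), of n "k + 1"] length_word_of[OF D(1)]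
      by simp
    moreover have "0 \<notin> set (word_of n (involution_map n \<pi>))" using word_of_no_zero_iff[OF D(1)] D(2) by blast
    ultimately show ?thesis
      using count_conjugate_pos_iff[OF lattice_word_of[OF D(1)], of k]
      unfolding involution_word_def by auto
  qed
  show "inj_on (involution_word n) ?A"
  proof (rule inj_onI)
    fix \<pi> \<rho> assume p: "\<pi> \<in> ?A" "\<rho> \<in> ?A" and eq: "involution_word n \<pi> = involution_word n \<rho>"
    have "word_of n (involution_map n \<pi>) = word_of n (involution_map n \<rho>)"
      using eq conjugate_conjugate lattice_word_of A[OF p(1)] A[OF p(2)]
      unfolding involution_word_def by metis
    then show "\<pi> = \<rho>" using word_of_inj involution_map_inj A[OF p(1)] A[OF p(2)] by blast
  qed
  show "involution_word n ` ?A = ballot_words k n"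
  proof (intro equalityI subsetI)
    fix w assume "w \<in> involution_word n ` ?A"
    then obtain \<pi> where p: "\<pi> \<in> ?A" "w = involution_word n \<pi>" by blast
    note D = A[OF p(1)]
    have "\<not> contains_pattern n \<pi> (k + 1) id" using p(1) by (simp add: avoiding_involutions_def)
    then have "set w \<subseteq> {1..k}" using one[OF D(3,4)] p(2) by blast
    moreover have "length w = n" "lattice_word w"
      using p(2) D length_word_of lattice_word_of lattice_word_conjugate
      by (simp_all add: involution_word_def)
    ultimately show "w \<in> ballot_words k n" by (simp add: ballot_words_def)
  next
    fix w assume w: "w \<in> ballot_words k n"
    then have w': "lattice_word w" "0 \<notin> set w" "length w = n" "set w \<subseteq> {1..k}"
      by (auto simp: ballot_words_def)
    obtain p where p: "partial_involution n p" "word_of n p = conjugate w"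
      using word_of_surj[OF lattice_word_conjugate[OF w'(1,2)]] w'(3) by auto
    have "dom p = {..<n}" using word_of_no_zero_iff[OF p(1)] p(2) conjugate_no_zero by simp
    then obtain \<pi> where \<pi>: "\<pi> permutes {1..n}" "\<pi> \<circ> \<pi> = id" "involution_map n \<pi> = p"
      using involution_map_surj[OF p(1)] by blast
    have iw: "involution_word n \<pi> = w"
      using \<pi>(3) p(2) conjugate_conjugate[OF w'(1,2)] by (simp add: involution_word_def)
    then have "\<pi> \<in> ?A" using one[OF \<pi>(1,2)] \<pi> w'(4) by (simp add: avoiding_involutions_def)
    then show "w \<in> involution_word n ` ?A" using iw by blast
  qed
qed

theorem fp_involution_word:
  assumes "\<pi> permutes {1..n}" "\<pi> \<circ> \<pi> = id"
  shows "fp n \<pi> = card (odd_letters (involution_word n \<pi>))"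
proof -
  note D = involution_mapD[OF assms]
  have "0 \<notin> set (word_of n (involution_map n \<pi>))" using word_of_no_zero_iff[OF D(1)] D(2) by blast
  then have "int (fp n \<pi>) = int (card (odd_letters (involution_word n \<pi>)))"
    using fp_involution_map[OF assms] fixed_points_word_of[OF D(1)]
      odd_letters_conjugate[OF lattice_word_of[OF D(1)]]
    by (simp add: involution_word_def)
  then show ?thesis by simp
qed

section \<open>The exponential growth rate of ballot words\<close>

lemma finite_ballot_words [simp]: "finite (ballot_words k n)"
  by (rule finite_subset[OF _ finite_lists_length_eq[of "{1..k}" n]]) (auto simp: ballot_words_def)

lemma card_ballot_words_Suc_le: "card (ballot_words k (Suc n)) \<le> k * card (ballot_words k n)"
proof -
  have "ballot_words k (Suc n) \<subseteq> (\<lambda>(w, x). w @ [x]) ` (ballot_words k n \<times> {1..k})"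
  proof
    fix w assume w: "w \<in> ballot_words k (Suc n)"
    then obtain u x where ux: "w = u @ [x]" by (cases w rule: rev_cases) (auto simp: ballot_words_def)
    then have "u \<in> ballot_words k n" "x \<in> {1..k}"
      using w lattice_word_prefix[of u "[x]"] by (auto simp: ballot_words_def)
    then show "w \<in> (\<lambda>(w, x). w @ [x]) ` (ballot_words k n \<times> {1..k})" using ux by auto
  qed
  then have "card (ballot_words k (Suc n)) \<le> card ((\<lambda>(w, x). w @ [x]) ` (ballot_words k n \<times> {1..k}))"
    by (intro card_mono) auto
  also have "\<dots> \<le> card (ballot_words k n \<times> {1..k})" by (rule card_image_le) auto
  finally show ?thesis by (simp add: card_cartesian_product mult.commute)
qed

lemma card_ballot_words_mono:
  assumes "k \<ge> 1" "m \<le> n"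
  shows "card (ballot_words k m) \<le> card (ballot_words k n)"
  using assms(2)
proof (induction rule: dec_induct)
  case (step n)
  have "card (ballot_words k n) \<le> card (ballot_words k (Suc n))"
  proof (rule card_inj_on_le)
    show "inj_on (\<lambda>w. w @ [1]) (ballot_words k n)" by (auto simp: inj_on_def)
    show "(\<lambda>w. w @ [1]) ` ballot_words k n \<subseteq> ballot_words k (Suc n)"
      using assms(1) by (auto simp: ballot_words_def lattice_word_snoc)
  qed auto
  with step.IH show ?case by simp
qed simp

lemma card_ballot_words_pos: "k \<ge> 1 \<Longrightarrow> 1 \<le> card (ballot_words k n)"
proof -
  assume "k \<ge> 1"
  moreover have "ballot_words k 0 = {[]}" by (auto simp: ballot_words_def)
  ultimately show ?thesis using card_ballot_words_mono[of k 0 n] by simp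
qed

definition balanced_words :: "nat \<Rightarrow> nat \<Rightarrow> nat list set" where
  "balanced_words k m = {v. length v = m \<and> set v \<subseteq> {1..k} \<and>
     (\<forall>a. 1 \<le> a \<longrightarrow> a < k \<longrightarrow> count_list v (Suc a) \<le> count_list v a)}"

text \<open>
  Every word becomes balanced after renaming its letters in the order of decreasing multiplicity, and
  there are at most \<open>k ^ k\<close> renamings.
\<close>

lemma card_balanced_words: "k ^ m \<le> k ^ k * card (balanced_words k m)"
proof -
  let ?W = "{w. set w \<subseteq> {1..k} \<and> length w = m}"
  let ?S = "{ls. set ls \<subseteq> {1..k} \<and> length ls = k}"
  have fin: "finite (balanced_words k m)"
    by (rule finite_subset[OF _ finite_lists_length_eq[of "{1..k}" m]]) (auto simp: balanced_words_def)
  have "?W \<subseteq> (\<lambda>(ls, v). map (\<lambda>a. ls ! (a - 1)) v) ` (?S \<times> balanced_words k m)"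
  proof
    fix w assume w: "w \<in> ?W"
    \<comment> \<open>The letters in the order of decreasing multiplicity in \<open>w\<close>.\<close>
    define ls where "ls = sort_key (\<lambda>a. m - count_list w a) [1..<Suc k]"
    have ls: "set ls = {1..k}" "length ls = k" "distinct ls" by (auto simp: ls_def)
    have srt: "count_list w (ls ! Suc i) \<le> count_list w (ls ! i)" if "Suc i < k" for i
    proof -
      have "sorted (map (\<lambda>a. m - count_list w a) ls)" unfolding ls_def by (rule sorted_sort_key)
      then have "m - count_list w (ls ! i) \<le> m - count_list w (ls ! Suc i)"
        using that ls(2) by (subst (asm) sorted_iff_nth_Suc) auto
      moreover have "count_list w (ls ! i) \<le> m" "count_list w (ls ! Suc i) \<le> m"
        using count_le_length[of w] w by auto
      ultimately show ?thesis by linarith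
    qed
    define g where "g a = ls ! (a - 1)" for a
    have bij: "bij_betw g {1..k} {1..k}"
    proof (rule bij_betwI')
      fix x y assume "x \<in> {1..k}" "y \<in> {1..k}"
      then show "g x = g y \<longleftrightarrow> x = y" using ls by (auto simp: g_def nth_eq_iff_index_eq)
    next
      fix x assume "x \<in> {1..k}"
      then have "g x \<in> set ls" using ls(2) by (auto simp: g_def)
      then show "g x \<in> {1..k}" using ls(1) by simp
    next
      fix y assume "y \<in> {1..k}"
      then obtain i where "i < k" "y = ls ! i" using ls by (metis in_set_conv_nth)
      then show "\<exists>x\<in>{1..k}. y = g x" by (intro bexI[of _ "Suc i"]) (auto simp: g_def)
    qed
    define h where "h = inv_into {1..k} g"
    have gh: "g (h a) = a" "h a \<in> {1..k}" if "a \<in> {1..k}" for a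
      using bij that unfolding h_def bij_betw_def by (metis f_inv_into_f, metis inv_into_into)
    define v where "v = map h w"
    have vw: "map g v = w"
    proof -
      have "map (g \<circ> h) w = map id w" by (rule map_cong) (use gh w in auto)
      then show ?thesis by (simp add: v_def)
    qed
    have setv: "set v \<subseteq> {1..k}" using gh w by (auto simp: v_def)
    have cnt: "count_list v a = count_list w (g a)" if a: "a \<in> {1..k}" for a
    proof (cases "a \<in> set v")
      case True
      have "inj_on g (set v)" using bij setv by (meson bij_betw_def inj_on_subset)
      then show ?thesis using count_list_inj_map[of g v a] True vw by simp
    next
      case False
      have "g a \<notin> g ` set v" using False setv a bij by (metis bij_betw_def inj_on_image_mem_iff)
      then have "g a \<notin> set w" using vw by (metis list.set_map)
      then show ?thesis using False by simp
    qed
    have "v \<in> balanced_words k m"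
    proof -
      have "count_list v (Suc a) \<le> count_list v a" if a: "1 \<le> a" "a < k" for a
        using cnt[of a] cnt[of "Suc a"] srt[of "a - 1"] a by (auto simp: g_def)
      then show ?thesis using setv w by (auto simp: balanced_words_def v_def)
    qed
    moreover have "ls \<in> ?S" using ls by auto
    moreover have "w = map (\<lambda>a. ls ! (a - 1)) v" using vw by (simp add: g_def[abs_def])
    ultimately show "w \<in> (\<lambda>(ls, v). map (\<lambda>a. ls ! (a - 1)) v) ` (?S \<times> balanced_words k m)"
      by (intro image_eqI[of _ _ "(ls, v)"]) auto
  qed
  then have "card ?W \<le> card ((\<lambda>(ls, v). map (\<lambda>a. ls ! (a - 1)) v) ` (?S \<times> balanced_words k m))"
    using fin by (intro card_mono finite_imageI finite_cartesian_product finite_lists_length_eq) auto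
  also have "\<dots> \<le> card (?S \<times> balanced_words k m)"
    using fin by (intro card_image_le finite_cartesian_product finite_lists_length_eq) auto
  finally show ?thesis by (simp add: card_cartesian_product card_lists_length_eq)
qed

text \<open>
  After such a word, any \<open>m\<close> letters of \<open>{1..k}\<close> may follow.
\<close>

definition wide :: "nat \<Rightarrow> nat \<Rightarrow> nat list \<Rightarrow> bool" where
  "wide k m x \<longleftrightarrow> lattice_word x \<and> (\<forall>a. 1 \<le> a \<longrightarrow> a < k \<longrightarrow> count_list x (Suc a) + m \<le> count_list x a)"

lemma lattice_word_append_wide:
  assumes "wide k m x" "length v \<le> m" "set v \<subseteq> {1..k}"
  shows "lattice_word (x @ v)"
  using assms(2,3)
proof (induction v rule: rev_induct)
  case (snoc b v)
  have L: "lattice_word (x @ v)" using snoc by simp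
  have "b \<le> 1 \<or> count_list (x @ v) b < count_list (x @ v) (b - 1)"
  proof (cases "b \<le> 1")
    case False
    then have "count_list x b + m \<le> count_list x (b - 1)"
      using assms(1) snoc.prems(2) unfolding wide_def by (auto dest!: spec[of _ "b - 1"])
    moreover have "count_list v b < m" using count_le_length[of v b] snoc.prems(1) by simp
    ultimately show ?thesis by simp
  qed simp
  then have "lattice_word ((x @ v) @ [b])" using L lattice_word_snoc by blast
  then show ?case by simp
qed (use assms(1) in \<open>simp add: wide_def\<close>)

lemma wide_append:
  assumes "wide k m x" "v \<in> balanced_words k m"
  shows "wide k m (x @ v)"
proof -
  have "lattice_word (x @ v)"
    using assms(2) by (intro lattice_word_append_wide[OF assms(1)]) (auto simp: balanced_words_def)
  moreover have "count_list (x @ v) (Suc a) + m \<le> count_list (x @ v) a" if "1 \<le> a" "a < k" for a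
  proof -
    have "count_list x (Suc a) + m \<le> count_list x a" "count_list v (Suc a) \<le> count_list v a"
      using assms that unfolding wide_def balanced_words_def by blast+
    then show ?thesis by simp
  qed
  ultimately show ?thesis unfolding wide_def by blast
qed

lemma wide_exists: "\<exists>x. wide k m x \<and> set x \<subseteq> {1..k}"
proof -
  have "\<exists>x. lattice_word x \<and> set x \<subseteq> {1..k} \<and>
          (\<forall>a. count_list x a = (if 1 \<le> a \<and> a \<le> j then (k - a) * m else 0))" if "j \<le> k" for j
    using that
  proof (induction j)
    case 0
    show ?case by (intro exI[of _ "[]"]) auto
  next
    case (Suc j)
    then obtain x where x: "lattice_word x" "set x \<subseteq> {1..k}"
      "\<And>a. count_list x a = (if 1 \<le> a \<and> a \<le> j then (k - a) * m else 0)" by auto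
    have rep: "count_list (replicate i b) a = (if a = b then i else 0)" for i a b :: nat
      by (induction i) auto
    have "lattice_word (x @ replicate i (Suc j))" if "i \<le> (k - Suc j) * m" for i
      using that
    proof (induction i)
      case (Suc i)
      have "Suc j \<le> 1 \<or> count_list (x @ replicate i (Suc j)) (Suc j) < count_list (x @ replicate i (Suc j)) j"
      proof (cases "j = 0")
        case False
        have "(k - Suc j) * m \<le> (k - j) * m" by (intro mult_right_mono) auto
        then have "i < (k - j) * m" using Suc.prems by linarith
        then show ?thesis using False x(3) rep by auto
      qed simp
      then have "lattice_word ((x @ replicate i (Suc j)) @ [Suc j])"
        by (subst lattice_word_snoc) (use Suc in simp)
      then show ?case by (simp add: replicate_append_same)
    qed (use x in simp)
    then show ?case using x rep Suc.prems
      by (intro exI[of _ "x @ replicate ((k - Suc j) * m) (Suc j)"]) auto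
  qed
  from this[of k] obtain x where x: "lattice_word x" "set x \<subseteq> {1..k}"
      "\<And>a. count_list x a = (if 1 \<le> a \<and> a \<le> k then (k - a) * m else 0)" by auto
  have "(k - Suc a) * m + m \<le> (k - a) * m" if "a < k" for a
  proof -
    have "k - a = Suc (k - Suc a)" using that by simp
    then show ?thesis by simp
  qed
  then have "wide k m x" unfolding wide_def using x by auto
  with x show ?thesis by blast
qed

text \<open>
  Balanced blocks of length \<open>m\<close> can be appended freely to a word all of whose gaps are at least \<open>m\<close>:
  inside a block the gaps shrink by at most \<open>m\<close>, and after it they are at least as large as before.
\<close>

lemma card_ballot_words_blocks:
  "\<exists>C. \<forall>t. card (balanced_words k m) ^ t \<le> card (ballot_words k (C + m * t))"
proof -
  obtain x where x: "wide k m x" "set x \<subseteq> {1..k}" using wide_exists by blast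
  have "card (balanced_words k m) ^ t \<le> card (ballot_words k (length x + m * t))" for t
  proof -
    let ?S = "{vs. set vs \<subseteq> balanced_words k m \<and> length vs = t}"
    have fin: "finite (balanced_words k m)"
      by (rule finite_subset[OF _ finite_lists_length_eq[of "{1..k}" m]]) (auto simp: balanced_words_def)
    have wide: "wide k m (x @ concat vs) \<and> length (concat vs) = m * length vs \<and> set (concat vs) \<subseteq> {1..k}"
      if "set vs \<subseteq> balanced_words k m" for vs
      using that
    proof (induction vs rule: rev_induct)
      case (snoc v vs)
      then have IH: "wide k m (x @ concat vs)" "length (concat vs) = m * length vs" "set (concat vs) \<subseteq> {1..k}"
        and v: "v \<in> balanced_words k m" by auto
      show ?case using wide_append[OF IH(1) v] IH(2,3) v by (auto simp: balanced_words_def)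
    qed (use x in auto)
    have "card ?S \<le> card (ballot_words k (length x + m * t))"
    proof (rule card_inj_on_le)
      show "inj_on (\<lambda>vs. x @ concat vs) ?S"
      proof (rule inj_onI)
        fix vs vs' assume vs: "vs \<in> ?S" "vs' \<in> ?S" and eq: "x @ concat vs = x @ concat vs'"
        have len: "length v = m" if "v \<in> set vs \<union> set vs'" for v
          using that vs by (auto simp: balanced_words_def)
        show "vs = vs'"
        proof (rule concat_injective)
          show "\<forall>(v, v')\<in>set (zip vs vs'). length v = length v'"
          proof clarify
            fix v v' assume "(v, v') \<in> set (zip vs vs')"
            then have "v \<in> set vs" "v' \<in> set vs'" by (auto dest: set_zip_leftD set_zip_rightD)
            then show "length v = length v'" using len by simp
          qed
        qed (use vs eq in auto)
      qed
      show "(\<lambda>vs. x @ concat vs) ` ?S \<subseteq> ballot_words k (length x + m * t)"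
      proof (rule image_subsetI)
        fix vs assume "vs \<in> ?S"
        then have "wide k m (x @ concat vs)" "length (concat vs) = m * t" "set (concat vs) \<subseteq> {1..k}"
          using wide[of vs] by auto
        then show "x @ concat vs \<in> ballot_words k (length x + m * t)"
          using x(2) by (simp add: ballot_words_def wide_def)
      qed
    qed simp
    then show ?thesis using fin by (simp add: card_lists_length_eq)
  qed
  then show ?thesis by blast
qed

text \<open>
  Appending balanced blocks of length \<open>m\<close> gives a growth rate of at least \<open>k ^ (1 - k / m)\<close>, which
  comes arbitrarily close to \<open>k\<close>.
\<close>

lemma ballot_words_growth:
  assumes "0 < c" "c < real k"
  shows "eventually (\<lambda>n. c ^ n \<le> real (card (ballot_words k n))) sequentially"
proof (cases "c \<le> 1")
  case True
  have k: "k \<ge> 1" using assms by (cases k) auto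
  have "c ^ n \<le> real (card (ballot_words k n))" for n
  proof -
    have "c ^ n \<le> 1" using True assms by (simp add: power_le_one)
    also have "1 \<le> real (card (ballot_words k n))" using card_ballot_words_pos[OF k, of n] by simp
    finally show ?thesis .
  qed
  then show ?thesis by simp
next
  case False
  define d where "d = (c + k) / 2"
  have d: "c < d" "d < k" "1 < d" using assms False by (auto simp: d_def)
  have k: "k \<ge> 1" using assms by (cases k) auto
  \<comment> \<open>For this block length the loss \<open>k ^ k\<close> in the number of balanced blocks is compensated by
    the margin between \<open>d\<close> and \<open>k\<close>.\<close>
  obtain m where m: "real k ^ k < (real k / d) ^ m"
    using real_arch_pow[of "real k / d"] d by auto
  have m0: "m > 0"
  proof (rule ccontr)
    assume "\<not> m > 0"
    then have "real k ^ k < 1" using m by simp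
    moreover have "1 \<le> real k ^ k" using k by (simp add: one_le_power)
    ultimately show False by simp
  qed
  have V: "d ^ m \<le> real (card (balanced_words k m))"
  proof -
    have "real k ^ k * d ^ m \<le> real k ^ m" using m d by (simp add: power_divide field_simps)
    also have "\<dots> \<le> real (k ^ k * card (balanced_words k m))"
      using card_balanced_words[of k m] by (metis of_nat_le_iff of_nat_power)
    finally show ?thesis using k by simp
  qed
  obtain C where C: "\<And>t. card (balanced_words k m) ^ t \<le> card (ballot_words k (C + m * t))"
    using card_ballot_words_blocks by blast
  have *: "d ^ n / d ^ (C + m) \<le> real (card (ballot_words k n))" if "n \<ge> C" for n
  proof -
    define t where "t = (n - C) div m"
    have t: "C + m * t \<le> n" "n \<le> C + m + m * t"
    proof -
      have "n - C = m * t + (n - C) mod m" unfolding t_def by simp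
      moreover have "(n - C) mod m < m" using m0 by simp
      ultimately show "C + m * t \<le> n" "n \<le> C + m + m * t" using that by linarith+
    qed
    have "d ^ n \<le> d ^ (C + m + m * t)" using t(2) d by (intro power_increasing) auto
    then have "d ^ n / d ^ (C + m) \<le> d ^ (m * t)" using d by (simp add: power_add field_simps)
    also have "\<dots> = (d ^ m) ^ t" by (rule power_mult)
    also have "\<dots> \<le> real (card (balanced_words k m)) ^ t" using V d by (intro power_mono) auto
    also have "\<dots> \<le> real (card (ballot_words k (C + m * t)))" using C[of t] by (metis of_nat_le_iff of_nat_power)
    also have "\<dots> \<le> real (card (ballot_words k n))" using card_ballot_words_mono[OF k t(1)] by simp
    finally show ?thesis .
  qed
  obtain N where N: "d ^ (C + m) < (d / c) ^ N"
    using real_arch_pow[of "d / c"] d assms by auto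
  show ?thesis
  proof (rule eventually_sequentiallyI[of "max C N"])
    fix n assume n: "max C N \<le> n"
    have "(d / c) ^ N \<le> (d / c) ^ n" using n d assms by (intro power_increasing) auto
    then have "d ^ (C + m) \<le> d ^ n / c ^ n" using N by (simp add: power_divide)
    then have "c ^ n \<le> d ^ n / d ^ (C + m)" using d assms by (simp add: field_simps)
    also have "\<dots> \<le> real (card (ballot_words k n))" using * n by simp
    finally show "c ^ n \<le> real (card (ballot_words k n))" .
  qed
qed

section \<open>Languages with a neutral letter\<close>

text \<open>
  The moment generating function of the number of occurrences of a letter in a random word.
\<close>

lemma sum_power_count_list:
  fixes \<theta> :: real
  assumes "finite B" "z \<in> B"
  shows "(\<Sum>w | set w \<subseteq> B \<and> length w = N. \<theta> ^ count_list w z) = (\<theta> + card B - 1) ^ N"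
proof (induction N)
  case 0
  have "{w. set w \<subseteq> B \<and> length w = 0} = {[]}" by auto
  then show ?case by simp
next
  case (Suc N)
  let ?W = "\<lambda>N. {w. set w \<subseteq> B \<and> length w = N}"
  have inj: "inj_on (\<lambda>(w, x). x # w) (?W N \<times> B)" by (auto simp: inj_on_def)
  have "(\<Sum>w\<in>?W (Suc N). \<theta> ^ count_list w z) = (\<Sum>(w, x)\<in>?W N \<times> B. \<theta> ^ count_list (x # w) z)"
    unfolding lists_length_Suc_eq using inj by (subst sum.reindex) (auto simp: case_prod_unfold)
  also have "\<dots> = (\<Sum>w\<in>?W N. \<Sum>x\<in>B. \<theta> ^ count_list w z * (if x = z then \<theta> else 1))"
    by (subst sum.cartesian_product[symmetric]) (auto intro!: sum.cong)
  also have "\<dots> = (\<Sum>w\<in>?W N. \<theta> ^ count_list w z) * (\<Sum>x\<in>B. if x = z then \<theta> else 1)"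
    by (rule sum_product[symmetric])
  also have "(\<Sum>x\<in>B. if x = z then \<theta> else 1) = \<theta> + card B - 1"
  proof -
    have "(\<Sum>x\<in>B. if x = z then \<theta> else 1) = \<theta> + (\<Sum>x\<in>B - {z}. if x = z then \<theta> else 1)"
      using assms by (subst sum.remove[of B z]) auto
    also have "(\<Sum>x\<in>B - {z}. if x = z then \<theta> else 1) = (\<Sum>x\<in>B - {z}. 1)"
      by (rule sum.cong) auto
    also have "\<dots> = real (card B) - 1"
    proof -
      have "1 \<le> card B" using assms by (metis One_nat_def Suc_leI card_gt_0_iff empty_iff)
      then show ?thesis using assms by (simp add: card_Diff_singleton of_nat_diff)
    qed
    finally show ?thesis by simp
  qed
  finally show ?case using Suc.IH by simp
qed

text \<open>
  Inserting \<open>z\<close> in one of the \<open>N + 1\<close> places of a word of length \<open>N\<close> gives a word of length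
  \<open>N + 1\<close> with a marked occurrence of \<open>z\<close>, and the marked word determines the original.
\<close>

lemma insertion_double_count:
  assumes B: "finite B"
    and L: "\<And>w. w \<in> L \<Longrightarrow> set w \<subseteq> B"
    and ins: "\<And>u v. u @ v \<in> L \<Longrightarrow> u @ z # v \<in> L"
  shows "Suc N * card {w\<in>L. length w = N} \<le> (\<Sum>w | w \<in> L \<and> length w = Suc N. count_list w z)"
proof -
  let ?L = "\<lambda>N. {w\<in>L. length w = N}"
  have fin: "finite (?L N)" for N
    by (rule finite_subset[OF _ finite_lists_length_eq[OF B, of N]]) (use L in auto)
  let ?P = "\<lambda>w. {i. i < length w \<and> z = w ! i}"
  have "card ({..N} \<times> ?L N) \<le> card (SIGMA w:?L (Suc N). ?P w)"
  proof (rule card_inj_on_le)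
    show "inj_on (\<lambda>(i, w). (take i w @ z # drop i w, i)) ({..N} \<times> ?L N)"
    proof (rule inj_onI)
      fix p p' assume "p \<in> {..N} \<times> ?L N" "p' \<in> {..N} \<times> ?L N"
        and eq: "(\<lambda>(i, w). (take i w @ z # drop i w, i)) p = (\<lambda>(i, w). (take i w @ z # drop i w, i)) p'"
      then obtain i w j w' where p: "p = (i, w)" "p' = (j, w')" "i \<le> N" "length w = N" "length w' = N"
        by auto
      then have "i = j" "take i w @ z # drop i w = take i w' @ z # drop i w'" using eq by auto
      then have "take i w = take i w'" "drop i w = drop i w'"
        using p(3-5) by (auto simp: append_eq_append_conv)
      then show "p = p'" using p \<open>i = j\<close> by (metis append_take_drop_id)
    qed
    show "(\<lambda>(i, w). (take i w @ z # drop i w, i)) ` ({..N} \<times> ?L N) \<subseteq> (SIGMA w:?L (Suc N). ?P w)"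
      using ins by (auto simp: nth_append)
    show "finite (SIGMA w:?L (Suc N). ?P w)" using fin by auto
  qed
  also have "\<dots> = (\<Sum>w\<in>?L (Suc N). card (?P w))" using fin by (intro card_SigmaI) auto
  also have "\<dots> = (\<Sum>w\<in>?L (Suc N). count_list w z)"
    by (simp add: count_list_eq_length_filter length_filter_conv_card)
  finally show ?thesis by (simp add: card_cartesian_product)
qed

text \<open>
  By double counting, \<open>T N / T (N + 1)\<close> is at most the mean frequency of \<open>z\<close> in the words of \<open>L\<close> of
  length \<open>N + 1\<close>.  Among all words over \<open>B\<close>, a frequency above some \<open>\<beta> > 1 / card B\<close> has exponentially
  small probability.  As \<open>L\<close> has the full exponential growth rate, such words are negligible in \<open>L\<close> too.
\<close>

lemma neutral_letter_ratio:
  fixes L :: "'a list set"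
  defines "T \<equiv> (\<lambda>N. real (card {w\<in>L. length w = N}))"
  assumes B: "finite B" and z: "z \<in> B"
    and L: "\<And>w. w \<in> L \<Longrightarrow> set w \<subseteq> B"
    and ins: "\<And>u v. u @ v \<in> L \<Longrightarrow> u @ z # v \<in> L"
    and pre: "\<And>w x. w @ [x] \<in> L \<Longrightarrow> w \<in> L"
    and growth: "\<And>c. 0 < c \<Longrightarrow> c < real (card B) \<Longrightarrow> eventually (\<lambda>N. c ^ N \<le> T N) sequentially"
  shows "(\<lambda>N. T (Suc N) / T N) \<longlonglongrightarrow> real (card B)"
proof -
  let ?L = "\<lambda>N. {w\<in>L. length w = N}"
  define K where "K = real (card B)"
  have fin: "finite (?L N)" for N
    by (rule finite_subset[OF _ finite_lists_length_eq[OF B, of N]]) (use L in auto)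
  have K: "K \<ge> 1" using B z unfolding K_def by (metis One_nat_def Suc_leI card_gt_0_iff empty_iff of_nat_1 of_nat_mono)
  have ev_pos: "eventually (\<lambda>N. 0 < T N) sequentially"
  proof -
    have "eventually (\<lambda>N. (1 / 2) ^ N \<le> T N) sequentially"
      using growth[of "1 / 2"] K unfolding K_def by simp
    then show ?thesis
    proof eventually_elim
      case (elim N)
      have "(0::real) < (1 / 2) ^ N" by simp
      with elim show ?case by linarith
    qed
  qed
  have upper: "T (Suc N) \<le> K * T N" for N
  proof -
    have "card (?L (Suc N)) \<le> card (?L N \<times> B)"
    proof (rule card_inj_on_le)
      show "inj_on (\<lambda>w. (butlast w, last w)) (?L (Suc N))"
      proof (rule inj_onI)
        fix w w' assume w: "w \<in> ?L (Suc N)" "w' \<in> ?L (Suc N)" and "(butlast w, last w) = (butlast w', last w')"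
        then have "butlast w @ [last w] = butlast w' @ [last w']" by simp
        moreover have "w \<noteq> []" "w' \<noteq> []" using w by auto
        ultimately show "w = w'" by simp
      qed
      show "(\<lambda>w. (butlast w, last w)) ` ?L (Suc N) \<subseteq> ?L N \<times> B"
      proof (clarsimp, intro conjI)
        fix w assume w: "w \<in> L" "length w = Suc N"
        then have ne: "w \<noteq> []" by auto
        then show "butlast w \<in> L" using w(1) pre by (metis append_butlast_last_id)
        show "last w \<in> B" using L[OF w(1)] ne last_in_set by blast
      qed
      show "finite (?L N \<times> B)" using fin B by simp
    qed
    also have "\<dots> = card (?L N) * card B" by (rule card_cartesian_product)
    finally have "real (card (?L (Suc N))) \<le> real (card (?L N) * card B)" by (rule of_nat_mono)
    then show ?thesis unfolding T_def K_def by (simp add: mult.commute)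
  qed
  have lower: "eventually (\<lambda>N. T N / T (Suc N) < a) sequentially" if a: "a > 1 / K" for a
  proof -
    define \<beta> where "\<beta> = (1 / K + a) / 2"
    have \<beta>: "1 / K < \<beta>" "\<beta> < a" using a by (auto simp: \<beta>_def)
    then have K\<beta>: "K * \<beta> > 1" using K by (simp add: field_simps)
    have \<beta>0: "\<beta> > 0" using \<beta> K by (smt (verit) zero_le_divide_1_iff)
    \<comment> \<open>The exponential tilt \<open>\<theta> = 1 + \<eta>\<close> must make the Chernoff bound \<open>\<rho>\<close> smaller than \<open>K\<close>;
      by \<open>ln (1 + \<eta>) \<ge> \<eta> / (1 + \<eta>)\<close> it suffices that \<open>1 + \<eta> < K * \<beta>\<close>.\<close>
    define \<eta> where "\<eta> = (K * \<beta> - 1) / 2"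
    have "\<eta> > 0" using K\<beta> by (simp add: \<eta>_def)
    moreover have "1 + (x - 1) / 2 < x" if "x > 1" for x :: real using that by (simp add: field_simps)
    then have "1 + \<eta> < K * \<beta>" using K\<beta> unfolding \<eta>_def by blast
    ultimately have \<eta>: "\<eta> > 0" "1 + \<eta> < K * \<beta>" .
    define \<theta> where "\<theta> = 1 + \<eta>"
    have \<theta>: "\<theta> > 1" using \<eta> by (simp add: \<theta>_def)
    define \<rho> where "\<rho> = (\<theta> + K - 1) / \<theta> powr \<beta>"
    have \<rho>0: "\<rho> > 0" using \<theta> K by (simp add: \<rho>_def)
    have "\<rho> < K"
    proof -
      have "ln (1 / \<theta>) \<le> 1 / \<theta> - 1" using \<theta> by (intro ln_le_minus_one) auto
      then have "\<eta> / \<theta> \<le> ln \<theta>" using \<theta> by (simp add: ln_div \<theta>_def field_simps)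
      then have "\<beta> * (\<eta> / \<theta>) \<le> \<beta> * ln \<theta>" using \<beta>0 by (intro mult_left_mono) auto
      moreover have "\<eta> / K < \<beta> * (\<eta> / \<theta>)"
      proof -
        have "\<eta> * \<theta> < \<eta> * (K * \<beta>)" using \<eta> by (simp add: \<theta>_def)
        then show ?thesis using \<theta> K by (simp add: field_simps)
      qed
      ultimately have less: "exp (\<eta> / K) < exp (\<beta> * ln \<theta>)" by simp
      have "1 + \<eta> / K \<le> exp (\<eta> / K)" by (rule exp_ge_add_one_self)
      also note less
      finally have "1 + \<eta> / K < \<theta> powr \<beta>" using \<theta> by (simp add: powr_def)
      then have "K * (1 + \<eta> / K) < K * \<theta> powr \<beta>" using K by simp
      moreover have "K * (1 + \<eta> / K) = \<theta> + K - 1" using K by (simp add: \<theta>_def field_simps)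
      ultimately show ?thesis using \<theta> by (simp add: \<rho>_def pos_divide_less_eq)
    qed
    define c where "c = (\<rho> + K) / 2"
    have c: "\<rho> < c" "c < K" "0 < c" using \<open>\<rho> < K\<close> \<rho>0 by (auto simp: c_def)
    have key: "T N \<le> \<beta> * T (Suc N) + \<rho> ^ Suc N" for N
    proof -
      define M where "M = Suc N"
      \<comment> \<open>Either the frequency is at most \<open>\<beta>\<close>, or the tilted weight exceeds 1.\<close>
      have bound: "real (count_list w z) \<le> \<beta> * M + M * (\<theta> ^ count_list w z / (\<theta> powr \<beta>) ^ M)"
        if "length w = M" for w
      proof (cases "real (count_list w z) \<le> \<beta> * M")
        case True
        then show ?thesis using \<theta> by (smt (verit) divide_nonneg_nonneg mult_nonneg_nonneg of_nat_0_le_iff powr_ge_zero zero_le_power)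
      next
        case False
        have "(\<theta> powr \<beta>) ^ M = \<theta> powr (\<beta> * M)" using \<theta> by (simp add: powr_powr flip: powr_realpow)
        also have "\<dots> \<le> \<theta> powr (count_list w z)" using False \<theta> by (intro powr_mono) auto
        also have "\<dots> = \<theta> ^ count_list w z" using \<theta> by (simp add: powr_realpow)
        finally have "1 \<le> \<theta> ^ count_list w z / (\<theta> powr \<beta>) ^ M" using \<theta> by (simp add: field_simps)
        then have "real M * 1 \<le> M * (\<theta> ^ count_list w z / (\<theta> powr \<beta>) ^ M)" by (intro mult_left_mono) auto
        moreover have "count_list w z \<le> M" using count_le_length[of w z] that by simp
        moreover have "0 \<le> \<beta> * M" using \<beta>0 by simp
        ultimately show ?thesis by linarith
      qed
      have "real M * T N \<le> (\<Sum>w\<in>?L M. real (count_list w z))"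
      proof -
        have "Suc N * card (?L N) \<le> (\<Sum>w\<in>?L (Suc N). count_list w z)"
          by (rule insertion_double_count[OF B]) (use L ins in auto)
        then have "real (Suc N * card (?L N)) \<le> real (\<Sum>w\<in>?L (Suc N). count_list w z)"
          by (rule of_nat_mono)
        then show ?thesis unfolding M_def T_def of_nat_mult of_nat_sum .
      qed
      also have "\<dots> \<le> (\<Sum>w\<in>?L M. \<beta> * M + M * (\<theta> ^ count_list w z / (\<theta> powr \<beta>) ^ M))"
        by (rule sum_mono) (use bound in auto)
      also have "\<dots> = \<beta> * M * T M + M * (\<Sum>w\<in>?L M. \<theta> ^ count_list w z) / (\<theta> powr \<beta>) ^ M"
        by (simp add: sum.distrib T_def sum_distrib_left sum_divide_distrib)
      also have "\<dots> \<le> \<beta> * M * T M + M * (\<Sum>w | set w \<subseteq> B \<and> length w = M. \<theta> ^ count_list w z) / (\<theta> powr \<beta>) ^ M"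
        using L \<theta> B by (intro add_left_mono divide_right_mono mult_left_mono sum_mono2)
          (auto simp: finite_lists_length_eq)
      also have "\<dots> = \<beta> * M * T M + M * \<rho> ^ M"
        using sum_power_count_list[OF B z, of \<theta> M] by (simp add: \<rho>_def K_def power_divide)
      finally have "real M * T N \<le> real M * (\<beta> * T M + \<rho> ^ M)" by (simp add: algebra_simps)
      then show ?thesis by (simp add: M_def)
    qed
    have "(\<lambda>N. (\<rho> / c) ^ N) \<longlonglongrightarrow> 0"
      using c \<rho>0 by (intro LIMSEQ_realpow_zero) auto
    then have "eventually (\<lambda>N. (\<rho> / c) ^ N < a - \<beta>) sequentially"
      using \<beta> by (intro order_tendstoD(2)) auto
    then have "eventually (\<lambda>N. (\<rho> / c) ^ N < a - \<beta> \<and> c ^ N \<le> T N) sequentially"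
      using growth[of c] c unfolding K_def by (auto intro: eventually_conj)
    then have "eventually (\<lambda>N. (\<rho> / c) ^ Suc N < a - \<beta> \<and> c ^ Suc N \<le> T (Suc N)) sequentially"
      by (rule eventually_compose_filterlim) (rule filterlim_Suc)
    then show ?thesis
    proof eventually_elim
      case (elim N)
      have T0: "0 < T (Suc N)" using elim c by (smt (verit) zero_less_power)
      have "\<rho> ^ Suc N = (\<rho> / c) ^ Suc N * c ^ Suc N" using c by (simp add: power_divide)
      also have "\<dots> \<le> (\<rho> / c) ^ Suc N * T (Suc N)" using elim c \<rho>0 by (intro mult_left_mono) auto
      also have "\<dots> < (a - \<beta>) * T (Suc N)" using elim T0 by (intro mult_strict_right_mono) auto
      finally have "T N < a * T (Suc N)" using key[of N] by (simp add: algebra_simps)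
      then show ?case using T0 by (simp add: field_simps)
    qed
  qed
  have "(\<lambda>N. T N / T (Suc N)) \<longlonglongrightarrow> 1 / K"
  proof (rule order_tendstoI)
    fix a assume a: "a < 1 / K"
    have "eventually (\<lambda>N. 0 < T (Suc N)) sequentially"
      using ev_pos by (rule eventually_compose_filterlim) (rule filterlim_Suc)
    then show "eventually (\<lambda>N. a < T N / T (Suc N)) sequentially"
    proof eventually_elim
      case (elim N)
      have "1 / K \<le> T N / T (Suc N)" using upper[of N] elim K by (simp add: field_simps)
      with a show ?case by simp
    qed
  qed (use lower in auto)
  then have "(\<lambda>N. inverse (T N / T (Suc N))) \<longlonglongrightarrow> inverse (1 / K)"
    by (rule tendsto_inverse) (use K in auto)
  then show ?thesis by (simp add: K_def)
qed

section \<open>Ratios of consecutive ballot numbers\<close>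

lemma count_list_upt: "count_list [i..<j] x = (if i \<le> x \<and> x < j then 1 else 0)"
  by (induction j) (auto simp: le_Suc_eq)

text \<open>
  The inserted block raises the multiplicities of all letters of \<open>{1..k}\<close> equally, one after the other
  starting with the letter 1.
\<close>

lemma lattice_word_insert_staircase:
  assumes "lattice_word (u @ v)"
  shows "lattice_word (u @ [1..<Suc k] @ v)"
  using assms
proof (induction v rule: rev_induct)
  case Nil
  show ?case
  proof (induction k)
    case (Suc k)
    have "Suc k \<le> 1 \<or> count_list (u @ [1..<Suc k]) (Suc k) < count_list (u @ [1..<Suc k]) k"
    proof (cases "k = 0")
      case False
      then have "count_list u (Suc k) \<le> count_list u k"
        using Nil lattice_wordD[of u k] by simp
      with False show ?thesis by (simp add: count_list_upt del: upt_Suc)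
    qed simp
    then have "lattice_word ((u @ [1..<Suc k]) @ [Suc k])"
      by (subst lattice_word_snoc) (use Suc in \<open>simp del: upt_Suc\<close>)
    then show ?case by simp
  qed (use Nil in simp)
next
  case (snoc b v)
  have uv: "lattice_word (u @ v)" "b \<le> 1 \<or> count_list (u @ v) b < count_list (u @ v) (b - 1)"
    using snoc.prems lattice_word_snoc[of "u @ v" b] by simp_all
  have "b \<le> 1 \<or> count_list (u @ [1..<Suc k] @ v) b < count_list (u @ [1..<Suc k] @ v) (b - 1)"
    using uv(2) by (auto simp: count_list_upt simp del: upt_Suc)
  then have "lattice_word ((u @ [1..<Suc k] @ v) @ [b])"
    using snoc.IH[OF uv(1)] lattice_word_snoc by blast
  then show ?case by simp
qed

lemma split_blocks:
  assumes "length w = k * N"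
  shows "\<exists>bs. length bs = N \<and> concat bs = w \<and> (\<forall>b\<in>set bs. length b = k \<and> set b \<subseteq> set w)"
  using assms
proof (induction N arbitrary: w)
  case (Suc N)
  have "length (drop k w) = k * N" using Suc.prems by simp
  then obtain bs where bs: "length bs = N" "concat bs = drop k w"
    "\<forall>b\<in>set bs. length b = k \<and> set b \<subseteq> set (drop k w)"
    using Suc.IH by blast
  have "\<forall>b\<in>set (take k w # bs). length b = k \<and> set b \<subseteq> set w"
    using bs(3) Suc.prems set_drop_subset[of k w] set_take_subset[of k w] by auto
  then show ?case using bs(1,2) by (intro exI[of _ "take k w # bs"]) simp
qed simp

text \<open>
  The blocks of length \<open>k\<close> are the letters of a language in which the block \<open>1 2 \<dots> k\<close> is neutral.
\<close>

lemma ballot_block_ratio: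
  assumes "k \<ge> 1"
  shows "(\<lambda>N. real (card (ballot_words k (k * Suc N))) / real (card (ballot_words k (k * N))))
           \<longlonglongrightarrow> real k ^ k"
proof -
  define B where "B = {b. set b \<subseteq> {1..k} \<and> length b = k}"
  define L where "L = {bs. set bs \<subseteq> B \<and> lattice_word (concat bs)}"
  have fB: "finite B" and cB: "card B = k ^ k"
    unfolding B_def by (simp_all add: finite_lists_length_eq card_lists_length_eq)
  have card_L: "card {bs\<in>L. length bs = N} = card (ballot_words k (k * N))" for N
  proof (rule bij_betw_same_card[of concat], rule bij_betw_imageI)
    have lenB: "length b = k" if "b \<in> set bs" "bs \<in> L" for b bs
      using that by (auto simp: L_def B_def)
    show "inj_on concat {bs\<in>L. length bs = N}"
    proof (rule inj_onI)
      fix bs bs' assume bs: "bs \<in> {bs\<in>L. length bs = N}" "bs' \<in> {bs\<in>L. length bs = N}"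
        and eq: "concat bs = concat bs'"
      show "bs = bs'"
      proof (rule concat_injective[OF eq])
        show "\<forall>(v, v')\<in>set (zip bs bs'). length v = length v'"
        proof clarify
          fix v v' assume "(v, v') \<in> set (zip bs bs')"
          then have "v \<in> set bs" "v' \<in> set bs'" by (auto dest: set_zip_leftD set_zip_rightD)
          then show "length v = length v'" using lenB bs by simp
        qed
      qed (use bs in simp)
    qed
    show "concat ` {bs\<in>L. length bs = N} = ballot_words k (k * N)"
    proof (intro equalityI subsetI)
      fix w assume "w \<in> concat ` {bs\<in>L. length bs = N}"
      then obtain bs where bs: "bs \<in> L" "length bs = N" "w = concat bs" by blast
      have len: "length (concat bs) = k * length bs" if "\<forall>b\<in>set bs. length b = k" for bs :: "nat list list"
        using that by (induction bs) auto
      have "length w = k * N" using len[of bs] lenB bs by simp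
      moreover have "set w \<subseteq> {1..k}" using bs by (auto simp: L_def B_def)
      ultimately show "w \<in> ballot_words k (k * N)" using bs by (simp add: ballot_words_def L_def)
    next
      fix w assume w: "w \<in> ballot_words k (k * N)"
      then obtain bs where "length bs = N" "concat bs = w" "\<forall>b\<in>set bs. length b = k \<and> set b \<subseteq> set w"
        using split_blocks[of w k N] by (auto simp: ballot_words_def)
      then have "bs \<in> {bs\<in>L. length bs = N}" using w by (auto simp: L_def B_def ballot_words_def)
      then show "w \<in> concat ` {bs\<in>L. length bs = N}" using \<open>concat bs = w\<close> by blast
    qed
  qed
  have growth: "eventually (\<lambda>N. c ^ N \<le> real (card {bs\<in>L. length bs = N})) sequentially"
    if c: "0 < c" "c < real (card B)" for c
  proof -
    define d where "d = root k c"
    have d: "0 < d" "d ^ k = c" using c assms by (simp_all add: d_def)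
    have "d < root k (real k ^ k)" unfolding d_def using c cB assms by (intro real_root_less_mono) auto
    then have "d < real k" using assms by (simp add: real_root_power_cancel)
    then have "eventually (\<lambda>n. d ^ n \<le> real (card (ballot_words k n))) sequentially"
      using d by (intro ballot_words_growth)
    then have "eventually (\<lambda>N. d ^ (k * N) \<le> real (card (ballot_words k (k * N)))) sequentially"
      by (rule eventually_compose_filterlim)
         (use assms in \<open>intro filterlim_subseq strict_monoI, simp\<close>)
    then show ?thesis by (simp add: card_L power_mult d)
  qed
  have "(\<lambda>N. real (card {bs\<in>L. length bs = Suc N}) / real (card {bs\<in>L. length bs = N}))
          \<longlonglongrightarrow> real (card B)"
  proof (rule neutral_letter_ratio[OF fB])
    show "[1..<Suc k] \<in> B" by (auto simp: B_def)
    show "u @ [1..<Suc k] # v \<in> L" if "u @ v \<in> L" for u v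
      using that \<open>[1..<Suc k] \<in> B\<close> lattice_word_insert_staircase[of "concat u" "concat v" k]
      by (simp add: L_def del: upt_Suc)
    show "w \<in> L" if "w @ [x] \<in> L" for w x
      using that lattice_word_prefix[of "concat w" x] by (simp add: L_def)
    show "eventually (\<lambda>N. c ^ N \<le> real (card {bs\<in>L. length bs = N})) sequentially"
      if "0 < c" "c < real (card B)" for c using growth that .
  qed (simp add: L_def)
  then show ?thesis by (simp add: card_L cB)
qed

lemma card_ballot_words_add_le: "card (ballot_words k (n + i)) \<le> k ^ i * card (ballot_words k n)"
proof (induction i)
  case (Suc i)
  have "card (ballot_words k (n + Suc i)) \<le> k * card (ballot_words k (n + i))"
    using card_ballot_words_Suc_le[of k "n + i"] by simp
  also have "\<dots> \<le> k * (k ^ i * card (ballot_words k n))" using Suc by (rule mult_le_mono2)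
  finally show ?case by (simp add: mult.assoc)
qed simp

text \<open>
  Among the \<open>k\<close> consecutive ratios between \<open>T (k * N)\<close> and \<open>T (k * (N + 1))\<close>, none exceeds \<open>k\<close>, while
  their product tends to \<open>k ^ k\<close>; so each of them tends to \<open>k\<close>.
\<close>

theorem ballot_ratio:
  assumes "k \<ge> 1"
  shows "(\<lambda>n. real (card (ballot_words k (Suc n))) / real (card (ballot_words k n))) \<longlonglongrightarrow> real k"
proof -
  define T where "T n = real (card (ballot_words k n))" for n
  have T0: "T n > 0" for n
    using card_ballot_words_pos[OF assms, of n] by (simp add: T_def)
  have add: "T (n + i) \<le> real k ^ i * T n" for n i
    using card_ballot_words_add_le[of k n i] unfolding T_def
    by (metis of_nat_le_iff of_nat_mult of_nat_power)
  define R where "R N = T (k * Suc N) / T (k * N)" for N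
  have k0: "real k > 0" using assms by simp
  \<comment> \<open>Of the \<open>k\<close> ratios in a block, all but one are estimated by \<open>k\<close>.\<close>
  have lower: "R (n div k) / real k ^ (k - 1) \<le> T (Suc n) / T n" for n
  proof -
    define N r where "N = n div k" and "r = n mod k"
    have n: "n = k * N + r" "r < k" using assms by (simp_all add: N_def r_def)
    have 1: "T n \<le> real k ^ r * T (k * N)" unfolding n(1) by (rule add)
    have "k * Suc N = Suc n + (k - Suc r)" using n by simp
    then have 2: "T (k * Suc N) \<le> real k ^ (k - Suc r) * T (Suc n)" using add[of "Suc n" "k - Suc r"] by simp
    have "k - 1 = r + (k - Suc r)" using n(2) by simp
    then have pw: "real k ^ (k - 1) = real k ^ r * real k ^ (k - Suc r)" by (simp add: power_add)
    have "T (k * Suc N) * T n \<le> (real k ^ (k - Suc r) * T (Suc n)) * (real k ^ r * T (k * N))"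
      using 1 2 T0 by (intro mult_mono) (auto simp: less_imp_le)
    then show ?thesis
      using T0 k0 unfolding N_def[symmetric] R_def pw by (simp add: field_simps)
  qed
  have upper: "T (Suc n) / T n \<le> real k" for n
    using add[of n 1] T0[of n] by (simp add: field_simps)
  have "R \<longlonglongrightarrow> real k ^ k" unfolding R_def T_def by (rule ballot_block_ratio[OF assms])
  then have "(\<lambda>n. R (n div k)) \<longlonglongrightarrow> real k ^ k"
  proof (rule filterlim_compose)
    show "filterlim (\<lambda>n. n div k) sequentially sequentially"
      unfolding filterlim_at_top
    proof
      fix Z
      show "eventually (\<lambda>n. Z \<le> n div k) sequentially"
        by (rule eventually_sequentiallyI[of "Z * k"]) (use assms in \<open>simp add: less_eq_div_iff_mult_less_eq\<close>)
    qed
  qed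
  then have "(\<lambda>n. R (n div k) / real k ^ (k - 1)) \<longlonglongrightarrow> real k ^ k / real k ^ (k - 1)"
    by (intro tendsto_divide tendsto_const) (use k0 in auto)
  moreover have "real k ^ k / real k ^ (k - 1) = real k"
    using assms by (cases k) auto
  ultimately have lim: "(\<lambda>n. R (n div k) / real k ^ (k - 1)) \<longlonglongrightarrow> real k" by simp
  have "(\<lambda>n. T (Suc n) / T n) \<longlonglongrightarrow> real k"
    by (rule tendsto_sandwich[OF _ _ lim tendsto_const]) (use lower upper in auto)
  then show ?thesis by (simp add: T_def)
qed

section \<open>Equidistribution of the letter parities\<close>

definition parity_character :: "nat set \<Rightarrow> nat list \<Rightarrow> real" where
  "parity_character S w = (\<Prod>a\<in>S. (- 1) ^ count_list w a)"

lemma abs_parity_character: "\<bar>parity_character S w\<bar> = 1"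
  by (simp add: parity_character_def abs_prod power_abs)

lemma parity_character_snoc:
  assumes "finite S"
  shows "parity_character S (w @ [a]) = parity_character S w * (if a \<in> S then - 1 else 1)"
proof -
  have "parity_character S (w @ [a]) = (\<Prod>b\<in>S. (- 1) ^ count_list w b * (if b = a then - 1 else 1))"
    unfolding parity_character_def by (rule prod.cong) auto
  also have "\<dots> = parity_character S w * (\<Prod>b\<in>S. if b = a then - 1 else 1)"
    by (simp add: parity_character_def prod.distrib)
  also have "(\<Prod>b\<in>S. if b = a then - 1 else 1 :: real) = (if a \<in> S then - 1 else 1)"
    using assms by (simp add: prod.delta)
  finally show ?thesis .
qed

text \<open>
  The iterates of a contraction forget their starting point, and the perturbations vanish in the limit.
\<close>

lemma recursive_contraction:
  fixes a e y :: "nat \<Rightarrow> real"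
  assumes a: "\<And>n. 0 \<le> a n" and q: "0 \<le> q" "q < 1"
    and rec: "eventually (\<lambda>n. a (Suc n) \<le> q * a n + e n) sequentially"
    and e: "e \<longlonglongrightarrow> 0"
  shows "a \<longlonglongrightarrow> 0"
proof (rule order_tendstoI)
  fix \<epsilon> :: real assume \<epsilon>: "0 < \<epsilon>"
  \<comment> \<open>With this \<open>\<delta>\<close> the map \<open>x \<mapsto> q * x + \<delta>\<close> has the fixed point \<open>\<epsilon> / 2\<close>.\<close>
  define \<delta> where "\<delta> = (1 - q) * \<epsilon> / 2"
  have "\<delta> > 0" using q \<epsilon> by (simp add: \<delta>_def)
  then have "eventually (\<lambda>n. e n < \<delta>) sequentially" using e by (intro order_tendstoD(2)) auto
  with rec have "eventually (\<lambda>n. a (Suc n) \<le> q * a n + \<delta>) sequentially"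
    by eventually_elim simp
  then obtain N where N: "\<And>n. n \<ge> N \<Longrightarrow> a (Suc n) \<le> q * a n + \<delta>"
    unfolding eventually_sequentially by blast
  have bound: "a (N + m) \<le> q ^ m * a N + \<epsilon> / 2" for m
  proof (induction m)
    case 0
    then show ?case using \<epsilon> by simp
  next
    case (Suc m)
    have "a (N + Suc m) \<le> q * a (N + m) + \<delta>" using N[of "N + m"] by simp
    also have "\<dots> \<le> q * (q ^ m * a N + \<epsilon> / 2) + \<delta>" using Suc q by (intro add_right_mono mult_left_mono)
    also have "\<dots> = q ^ Suc m * a N + \<epsilon> / 2" by (simp add: \<delta>_def field_simps)
    finally show ?case .
  qed
  have "(\<lambda>m. q ^ m * a N) \<longlonglongrightarrow> 0 * a N"
    using q by (intro tendsto_mult tendsto_const LIMSEQ_realpow_zero)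
  then have "eventually (\<lambda>m. q ^ m * a N < \<epsilon> / 2) sequentially"
    using \<epsilon> by (intro order_tendstoD(2)) auto
  then obtain m0 where m0: "\<And>m. m \<ge> m0 \<Longrightarrow> q ^ m * a N < \<epsilon> / 2"
    unfolding eventually_sequentially by blast
  show "eventually (\<lambda>n. a n < \<epsilon>) sequentially"
  proof (rule eventually_sequentiallyI[of "N + m0"])
    fix n assume n: "N + m0 \<le> n"
    then have "a n \<le> q ^ (n - N) * a N + \<epsilon> / 2" using bound[of "n - N"] by simp
    also have "\<dots> < \<epsilon>"
    proof -
      have "m0 \<le> n - N" using n by simp
      then have "q ^ (n - N) * a N < \<epsilon> / 2" by (rule m0)
      then show ?thesis by linarith
    qed
    finally show "a n < \<epsilon>" .
  qed
next
  fix \<epsilon> :: real assume "\<epsilon> < 0"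
  then show "eventually (\<lambda>n. \<epsilon> < a n) sequentially"
    using a by (intro always_eventually allI) (meson less_le_trans)
qed

text \<open>
  If every letter of \<open>{1..k}\<close> could follow every ballot word, the character sum would be multiplied by
  \<open>k - 2 * card S\<close>.  Each forbidden extension causes an error of at most 1.
\<close>

lemma parity_character_recurrence:
  assumes S: "S \<subseteq> {1..k}"
  shows "\<bar>(\<Sum>w\<in>ballot_words k (Suc n). parity_character S w)
           - (real k - 2 * card S) * (\<Sum>w\<in>ballot_words k n. parity_character S w)\<bar>
         \<le> real k * card (ballot_words k n) - card (ballot_words k (Suc n))"
proof -
  \<comment> \<open>The letters that may follow \<open>w\<close>.\<close>
  define A where "A w = {a\<in>{1..k}. a \<le> 1 \<or> count_list w a < count_list w (a - 1)}" for w
  define \<epsilon> where "\<epsilon> a = (if a \<in> S then - 1 else 1 :: real)" for a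
  have fS: "finite S" using S finite_subset by blast
  have fA: "finite (A w)" "A w \<subseteq> {1..k}" for w by (auto simp: A_def)
  have bij: "bij_betw (\<lambda>(w, a). w @ [a]) (SIGMA w:ballot_words k n. A w) (ballot_words k (Suc n))"
  proof (rule bij_betw_imageI)
    show "inj_on (\<lambda>(w, a). w @ [a]) (SIGMA w:ballot_words k n. A w)" by (auto simp: inj_on_def)
    show "(\<lambda>(w, a). w @ [a]) ` (SIGMA w:ballot_words k n. A w) = ballot_words k (Suc n)"
    proof (intro equalityI subsetI)
      fix w assume "w \<in> (\<lambda>(w, a). w @ [a]) ` (SIGMA w:ballot_words k n. A w)"
      then show "w \<in> ballot_words k (Suc n)" by (auto simp: ballot_words_def A_def lattice_word_snoc)
    next
      fix w assume w: "w \<in> ballot_words k (Suc n)"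
      then obtain u x where ux: "w = u @ [x]" by (cases w rule: rev_cases) (auto simp: ballot_words_def)
      then have "(u, x) \<in> (SIGMA w:ballot_words k n. A w)"
        using w by (auto simp: ballot_words_def A_def lattice_word_snoc)
      then show "w \<in> (\<lambda>(w, a). w @ [a]) ` (SIGMA w:ballot_words k n. A w)"
        using ux by (intro image_eqI[of _ _ "(u, x)"]) auto
    qed
  qed
  have "card (ballot_words k (Suc n)) = card (SIGMA w:ballot_words k n. A w)"
    using bij_betw_same_card[OF bij] by simp
  also have "\<dots> = (\<Sum>w\<in>ballot_words k n. card (A w))" using fA by (intro card_SigmaI) auto
  finally have card_Suc: "real (card (ballot_words k (Suc n))) = (\<Sum>w\<in>ballot_words k n. real (card (A w)))"
    by simp
  have "(\<Sum>w\<in>ballot_words k (Suc n). parity_character S w) =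
        (\<Sum>(w, a)\<in>(SIGMA w:ballot_words k n. A w). parity_character S (w @ [a]))"
    using sum.reindex_bij_betw[OF bij, of "parity_character S"] by (simp add: case_prod_unfold)
  also have "\<dots> = (\<Sum>w\<in>ballot_words k n. \<Sum>a\<in>A w. parity_character S (w @ [a]))"
    using fA by (subst sum.Sigma) auto
  also have "\<dots> = (\<Sum>w\<in>ballot_words k n. parity_character S w * (\<Sum>a\<in>A w. \<epsilon> a))"
    by (simp add: parity_character_snoc[OF fS] \<epsilon>_def sum_distrib_left)
  finally have eq: "(\<Sum>w\<in>ballot_words k (Suc n). parity_character S w)
           - (real k - 2 * card S) * (\<Sum>w\<in>ballot_words k n. parity_character S w)
      = (\<Sum>w\<in>ballot_words k n. parity_character S w * ((\<Sum>a\<in>A w. \<epsilon> a) - (real k - 2 * card S)))"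
    by (simp add: sum_distrib_left sum_subtractf sum.distrib algebra_simps)
  have all: "(\<Sum>a\<in>{1..k}. \<epsilon> a) = real k - 2 * card S"
  proof -
    have "(\<Sum>a\<in>{1..k}. \<epsilon> a) = (\<Sum>a\<in>{1..k} - S. \<epsilon> a) + (\<Sum>a\<in>S. \<epsilon> a)"
      using S by (intro sum.subset_diff) auto
    also have "(\<Sum>a\<in>{1..k} - S. \<epsilon> a) = (\<Sum>a\<in>{1..k} - S. 1)"
      by (rule sum.cong) (auto simp: \<epsilon>_def)
    also have "\<dots> = real (card {1..k} - card S)" using S fS by (simp add: card_Diff_subset)
    also have "\<dots> = real k - real (card S)" using card_mono[OF _ S] by (simp add: of_nat_diff)
    also have "(\<Sum>a\<in>S. \<epsilon> a) = - real (card S)" by (simp add: \<epsilon>_def)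
    finally show ?thesis by simp
  qed
  have part: "\<bar>(\<Sum>a\<in>A w. \<epsilon> a) - (real k - 2 * card S)\<bar> \<le> real k - real (card (A w))" for w
  proof -
    have "(\<Sum>a\<in>{1..k}. \<epsilon> a) = (\<Sum>a\<in>{1..k} - A w. \<epsilon> a) + (\<Sum>a\<in>A w. \<epsilon> a)"
      using fA by (intro sum.subset_diff) auto
    then have "\<bar>(\<Sum>a\<in>A w. \<epsilon> a) - (real k - 2 * card S)\<bar> = \<bar>\<Sum>a\<in>{1..k} - A w. \<epsilon> a\<bar>" using all by simp
    also have "\<dots> \<le> (\<Sum>a\<in>{1..k} - A w. \<bar>\<epsilon> a\<bar>)" by (rule sum_abs)
    also have "\<dots> = (\<Sum>a\<in>{1..k} - A w. 1)" by (rule sum.cong) (auto simp: \<epsilon>_def)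
    also have "\<dots> = real (card {1..k} - card (A w))" using fA by (simp add: card_Diff_subset)
    also have "\<dots> = real k - real (card (A w))" using card_mono[OF _ fA(2)] by (simp add: of_nat_diff)
    finally show ?thesis .
  qed
  have "\<bar>\<Sum>w\<in>ballot_words k n. parity_character S w * ((\<Sum>a\<in>A w. \<epsilon> a) - (real k - 2 * card S))\<bar>
      \<le> (\<Sum>w\<in>ballot_words k n. \<bar>parity_character S w * ((\<Sum>a\<in>A w. \<epsilon> a) - (real k - 2 * card S))\<bar>)"
    by (rule sum_abs)
  also have "\<dots> \<le> (\<Sum>w\<in>ballot_words k n. real k - real (card (A w)))"
    by (rule sum_mono) (use part in \<open>simp add: abs_mult abs_parity_character\<close>)
  also have "\<dots> = real k * card (ballot_words k n) - card (ballot_words k (Suc n))"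
    by (simp add: card_Suc sum_subtractf mult.commute)
  finally show ?thesis unfolding eq .
qed

text \<open>
  The forbidden extensions are a vanishing proportion by \<open>ballot_ratio\<close>, and
  \<open>\<bar>k - 2 * card S\<bar> < k\<close> for a nonempty proper subset \<open>S\<close>.
\<close>

lemma parity_character_average:
  assumes "k \<ge> 1" "S \<subseteq> {1..k}" "S \<noteq> {}" "S \<noteq> {1..k}"
  shows "(\<lambda>n. (\<Sum>w\<in>ballot_words k n. parity_character S w) / card (ballot_words k n)) \<longlonglongrightarrow> 0"
proof -
  define T where "T n = real (card (ballot_words k n))" for n
  define \<sigma> where "\<sigma> n = (\<Sum>w\<in>ballot_words k n. parity_character S w)" for n
  define y where "y n = T (Suc n) / T n" for n
  define s where "s = \<bar>real k - 2 * card S\<bar>"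
  have fS: "finite S" using assms(2) finite_subset by blast
  have "0 < card S" using fS assms(3) by (simp add: card_gt_0_iff)
  moreover have "card S < k" using psubset_card_mono[of "{1..k}" S] assms(2,4) by auto
  ultimately have s: "0 \<le> s" "s < real k" by (auto simp: s_def)
  have T0: "T n > 0" for n
    using card_ballot_words_pos[OF assms(1), of n] by (simp add: T_def)
  have y: "y \<longlonglongrightarrow> real k" unfolding y_def T_def by (rule ballot_ratio[OF assms(1)])
  have y0: "y n > 0" for n using T0 by (simp add: y_def)
  define q where "q = (s / real k + 1) / 2"
  have q: "s / real k < q" "0 \<le> q" "q < 1" using s by (auto simp: q_def field_simps)
  have k0: "real k > 0" using assms(1) by simp
  have "(\<lambda>n. s / y n) \<longlonglongrightarrow> s / real k" using y k0 by (intro tendsto_divide tendsto_const) auto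
  then have ev: "eventually (\<lambda>n. s / y n < q) sequentially" using q by (intro order_tendstoD(2)) auto
  have "(\<lambda>n. \<bar>\<sigma> n / T n\<bar>) \<longlonglongrightarrow> 0"
  proof (rule recursive_contraction[where q = q and e = "\<lambda>n. (real k - y n) / y n"])
    have "(\<lambda>n. (real k - y n) / y n) \<longlonglongrightarrow> (real k - real k) / real k"
      using y k0 by (intro tendsto_divide tendsto_diff tendsto_const) auto
    then show "(\<lambda>n. (real k - y n) / y n) \<longlonglongrightarrow> 0" by simp
    show "eventually (\<lambda>n. \<bar>\<sigma> (Suc n) / T (Suc n)\<bar> \<le> q * \<bar>\<sigma> n / T n\<bar> + (real k - y n) / y n) sequentially"
      using ev
    proof eventually_elim
      case (elim n)
      have "\<bar>\<sigma> (Suc n) - (real k - 2 * card S) * \<sigma> n\<bar> \<le> real k * T n - T (Suc n)"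
        unfolding \<sigma>_def T_def by (rule parity_character_recurrence[OF assms(2)])
      then have "\<bar>\<sigma> (Suc n)\<bar> \<le> \<bar>(real k - 2 * card S) * \<sigma> n\<bar> + (real k * T n - T (Suc n))" by linarith
      then have "\<bar>\<sigma> (Suc n)\<bar> \<le> s * \<bar>\<sigma> n\<bar> + (real k * T n - T (Suc n))" by (simp add: s_def abs_mult)
      then have "\<bar>\<sigma> (Suc n)\<bar> / T (Suc n) \<le> (s * \<bar>\<sigma> n\<bar> + (real k * T n - T (Suc n))) / T (Suc n)"
        using T0 by (simp add: divide_right_mono less_imp_le)
      also have "\<dots> = (s / y n) * (\<bar>\<sigma> n\<bar> / T n) + (real k - y n) / y n"
        using T0[of n] T0[of "Suc n"] by (simp add: y_def field_simps)
      also have "\<dots> \<le> q * (\<bar>\<sigma> n\<bar> / T n) + (real k - y n) / y n"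
        using elim T0[of n] by (intro add_right_mono mult_right_mono) auto
      finally show ?case using T0[of n] T0[of "Suc n"] by (simp add: abs_divide)
    qed
  qed (use q in auto)
  then show ?thesis unfolding \<sigma>_def T_def by (rule tendsto_rabs_zero_cancel)
qed

lemma odd_letters_subset: "w \<in> ballot_words k n \<Longrightarrow> odd_letters w \<subseteq> {1..k}"
proof
  fix a assume w: "w \<in> ballot_words k n" and "a \<in> odd_letters w"
  then have "count_list w a \<noteq> 0" unfolding odd_letters_def by (metis even_zero mem_Collect_eq)
  then have "a \<in> set w" by (metis count_notin)
  then show "a \<in> {1..k}" using w by (auto simp: ballot_words_def)
qed

text \<open>
  Fourier inversion on the group of subsets of \<open>{1..k}\<close>.
\<close>

lemma odd_letters_indicator:
  assumes "E \<subseteq> {1..k}" "odd_letters w \<subseteq> {1..k}"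
  shows "(if odd_letters w = E then 1 else 0 :: real) =
           (\<Sum>S\<in>Pow {1..k}. (- 1) ^ card (S \<inter> E) * parity_character S w) / 2 ^ k"
proof -
  define s where "s a = (if a \<in> E then - 1 else 1 :: real)" for a
  have fin: "finite S" if "S \<in> Pow {1..k}" for S using that finite_subset by blast
  have s: "(\<Prod>a\<in>S. s a) = (- 1) ^ card (S \<inter> E)" if "finite S" for S
    unfolding s_def using that by (simp add: prod.If_cases)
  have "(\<Prod>a\<in>{1..k}. s a * (- 1) ^ count_list w a + 1) =
      (\<Sum>S\<in>Pow {1..k}. (\<Prod>a\<in>S. s a * (- 1) ^ count_list w a) * (\<Prod>a\<in>{1..k} - S. 1))"
    by (rule prod_add) simp
  also have "\<dots> = (\<Sum>S\<in>Pow {1..k}. (- 1) ^ card (S \<inter> E) * parity_character S w)"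
    by (rule sum.cong) (simp_all add: prod.distrib s fin parity_character_def)
  finally have P: "(\<Prod>a\<in>{1..k}. s a * (- 1) ^ count_list w a + 1) =
      (\<Sum>S\<in>Pow {1..k}. (- 1) ^ card (S \<inter> E) * parity_character S w)" .
  have "(\<Prod>a\<in>{1..k}. s a * (- 1) ^ count_list w a + 1) = (if odd_letters w = E then 2 ^ k else 0)"
  proof (cases "odd_letters w = E")
    case True
    have "(\<Prod>a\<in>{1..k}. s a * (- 1) ^ count_list w a + 1) = (\<Prod>a\<in>{1..k}. 2 :: real)"
      by (rule prod.cong) (auto simp: s_def True[symmetric] odd_letters_def)
    then show ?thesis using True by simp
  next
    case False
    then obtain a where a: "a \<in> {1..k}" "a \<in> odd_letters w \<longleftrightarrow> a \<notin> E" using assms by blast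
    then have "s a * (- 1) ^ count_list w a + 1 = 0" by (auto simp: s_def odd_letters_def)
    then have "(\<Prod>a\<in>{1..k}. s a * (- 1) ^ count_list w a + 1) = 0"
      using a(1) by (intro prod_zero) auto
    then show ?thesis using False by simp
  qed
  then show ?thesis using P by (simp split: if_splits)
qed

lemma parity_character_full:
  assumes "w \<in> ballot_words k n"
  shows "parity_character {1..k} w = (- 1) ^ n"
proof -
  have "sum (count_list w) {1..k} = length w"
    using assms by (intro sum_count_set) (auto simp: ballot_words_def)
  then show ?thesis using assms by (simp add: parity_character_def ballot_words_def flip: power_sum)
qed

text \<open>
  In the Fourier expansion only the empty set and the full set contribute in the limit.  The
  character of the full set is the constant \<open>(- 1) ^ n\<close>, which expresses the parity constraint.
\<close>

theorem odd_letters_equidistributed: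
  assumes "k \<ge> 1" "E \<subseteq> {1..k}"
  shows "(\<lambda>n. card {w\<in>ballot_words k n. odd_letters w = E} / card (ballot_words k n)
           - (1 + (- 1) ^ (card E + n)) / 2 ^ k) \<longlonglongrightarrow> (0::real)"
proof -
  define T where "T n = real (card (ballot_words k n))" for n
  define \<sigma> where "\<sigma> S n = (\<Sum>w\<in>ballot_words k n. parity_character S w)" for S n
  define P where "P = Pow {1..k} - {{}, {1..k}}"
  have T0: "T n > 0" for n
    using card_ballot_words_pos[OF assms(1), of n] by (simp add: T_def)
  have ne: "{1..k} \<noteq> {}" using assms(1) by auto
  have fE: "finite E" using assms(2) finite_subset by blast
  have split: "(\<Sum>S\<in>Pow {1..k}. g S) = g {} + (g {1..k} + (\<Sum>S\<in>P. g S))" for g :: "nat set \<Rightarrow> real"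
  proof -
    have "Pow {1..k} = insert {} (insert {1..k} P)" by (auto simp: P_def)
    moreover have "finite P" "{} \<notin> insert {1..k} P" "{1..k} \<notin> P" using ne by (auto simp: P_def)
    ultimately show ?thesis by (simp del: atLeastAtMost_iff)
  qed
  have eq: "card {w\<in>ballot_words k n. odd_letters w = E} / card (ballot_words k n)
           - (1 + (- 1) ^ (card E + n)) / 2 ^ k =
        (\<Sum>S\<in>P. (- 1) ^ card (S \<inter> E) / 2 ^ k * (\<sigma> S n / T n))" for n
  proof -
    have "real (card {w\<in>ballot_words k n. odd_letters w = E}) =
        (\<Sum>w\<in>ballot_words k n. if odd_letters w = E then 1 else 0)"
      by (simp add: sum.If_cases Int_def)
    also have "\<dots> = (\<Sum>w\<in>ballot_words k n. (\<Sum>S\<in>Pow {1..k}. (- 1) ^ card (S \<inter> E) * parity_character S w) / 2 ^ k)"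
      by (rule sum.cong) (simp_all only: odd_letters_indicator[OF assms(2) odd_letters_subset])
    also have "\<dots> = (\<Sum>S\<in>Pow {1..k}. (- 1) ^ card (S \<inter> E) * \<sigma> S n) / 2 ^ k"
      unfolding sum_divide_distrib[symmetric] \<sigma>_def sum_distrib_left by (subst sum.swap) simp
    also have "\<dots> = (T n + (- 1) ^ card E * ((- 1) ^ n * T n) + (\<Sum>S\<in>P. (- 1) ^ card (S \<inter> E) * \<sigma> S n)) / 2 ^ k"
    proof -
      have "\<sigma> {} n = T n" by (simp add: \<sigma>_def T_def parity_character_def)
      moreover have "\<sigma> {1..k} n = (- 1) ^ n * T n"
        unfolding \<sigma>_def T_def using parity_character_full by (simp cong: sum.cong)
      moreover have "{1..k} \<inter> E = E" using assms(2) by blast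
      ultimately show ?thesis unfolding split by simp
    qed
    finally have "card {w\<in>ballot_words k n. odd_letters w = E} / T n =
        (1 + (- 1) ^ (card E + n)) / 2 ^ k + (\<Sum>S\<in>P. (- 1) ^ card (S \<inter> E) * \<sigma> S n) / 2 ^ k / T n"
      using T0[of n] by (simp add: power_add field_simps)
    then show ?thesis by (simp add: T_def sum_divide_distrib)
  qed
  have "(\<lambda>n. \<Sum>S\<in>P. (- 1) ^ card (S \<inter> E) / 2 ^ k * (\<sigma> S n / T n)) \<longlonglongrightarrow> (\<Sum>S\<in>P. (- 1) ^ card (S \<inter> E) / 2 ^ k * 0)"
    unfolding \<sigma>_def T_def
    by (intro tendsto_sum tendsto_mult tendsto_const parity_character_average[OF assms(1)]) (auto simp: P_def)
  then show ?thesis unfolding eq by simp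
qed

theorem odd_letter_count_limit:
  assumes "k \<ge> 1"
  shows "(\<lambda>n. card {w\<in>ballot_words k n. card (odd_letters w) = j} / card (ballot_words k n)
           - (k choose j) * (1 + (- 1) ^ (j + n)) / 2 ^ k) \<longlonglongrightarrow> (0::real)"
proof -
  define P where "P = {E. E \<subseteq> {1..k} \<and> card E = j}"
  have fP: "finite P" unfolding P_def by (rule finite_subset[of _ "Pow {1..k}"]) auto
  have cP: "card P = k choose j" using n_subsets[of "{1..k}" j] by (simp add: P_def)
  have eq: "card {w\<in>ballot_words k n. card (odd_letters w) = j} / card (ballot_words k n)
           - (k choose j) * (1 + (- 1) ^ (j + n)) / 2 ^ k =
      (\<Sum>E\<in>P. card {w\<in>ballot_words k n. odd_letters w = E} / card (ballot_words k n)
           - (1 + (- 1) ^ (card E + n)) / 2 ^ k)" for n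
  proof -
    have "{w\<in>ballot_words k n. card (odd_letters w) = j} = (\<Union>E\<in>P. {w\<in>ballot_words k n. odd_letters w = E})"
      using odd_letters_subset by (auto simp: P_def)
    also have "card \<dots> = (\<Sum>E\<in>P. card {w\<in>ballot_words k n. odd_letters w = E})"
      using fP by (intro card_UN_disjoint) auto
    finally have 1: "real (card {w\<in>ballot_words k n. card (odd_letters w) = j}) =
        (\<Sum>E\<in>P. real (card {w\<in>ballot_words k n. odd_letters w = E}))" by simp
    have "(\<Sum>E\<in>P. (1 + (- 1) ^ (card E + n)) / 2 ^ k :: real) = (\<Sum>E\<in>P. (1 + (- 1) ^ (j + n)) / 2 ^ k)"
      by (rule sum.cong) (auto simp: P_def)
    also have "\<dots> = (k choose j) * (1 + (- 1) ^ (j + n)) / 2 ^ k" by (simp add: cP)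
    finally show ?thesis unfolding 1 by (simp add: sum_subtractf sum_divide_distrib)
  qed
  have "(\<lambda>n. \<Sum>E\<in>P. card {w\<in>ballot_words k n. odd_letters w = E} / card (ballot_words k n)
           - (1 + (- 1) ^ (card E + n)) / 2 ^ k :: real) \<longlonglongrightarrow> (\<Sum>E\<in>P. 0)"
    by (intro tendsto_sum odd_letters_equidistributed[OF assms]) (auto simp: P_def)
  then show ?thesis unfolding eq by simp
qed

section \<open>Convergence in distribution\<close>

lemma card_involutions_fp:
  "card {\<pi>\<in>avoiding_involutions n (k + 1) id. fp n \<pi> = j} =
     card {w\<in>ballot_words k n. card (odd_letters w) = j}"
proof (rule bij_betw_same_card)
  let ?A = "avoiding_involutions n (k + 1) id"
  have fp: "fp n \<pi> = card (odd_letters (involution_word n \<pi>))" if "\<pi> \<in> ?A" for \<pi>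
    using that by (intro fp_involution_word) (auto simp: avoiding_involutions_def)
  have bij: "bij_betw (involution_word n) ?A (ballot_words k n)" by (rule involution_word_bij)
  show "bij_betw (involution_word n) {\<pi>\<in>?A. fp n \<pi> = j} {w\<in>ballot_words k n. card (odd_letters w) = j}"
  proof (rule bij_betw_subset[OF bij])
    show "involution_word n ` {\<pi>\<in>?A. fp n \<pi> = j} = {w\<in>ballot_words k n. card (odd_letters w) = j}"
    proof (intro equalityI subsetI)
      fix w assume "w \<in> involution_word n ` {\<pi>\<in>?A. fp n \<pi> = j}"
      then obtain \<pi> where "\<pi> \<in> ?A" "fp n \<pi> = j" "w = involution_word n \<pi>" by blast
      then show "w \<in> {w\<in>ballot_words k n. card (odd_letters w) = j}"
        using fp[of \<pi>] bij_betwE[OF bij] by simp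
    next
      fix w assume w: "w \<in> {w\<in>ballot_words k n. card (odd_letters w) = j}"
      then obtain \<pi> where "\<pi> \<in> ?A" "w = involution_word n \<pi>"
        using bij_betw_imp_surj_on[OF bij] by blast
      then show "w \<in> involution_word n ` {\<pi>\<in>?A. fp n \<pi> = j}"
        using fp[of \<pi>] w by auto
    qed
  qed auto
qed

lemma finite_avoiding_involutions: "finite (avoiding_involutions n (k + 1) id)"
  using bij_betw_finite[OF involution_word_bij] by simp

lemma fp_le:
  assumes "\<pi> \<in> avoiding_involutions n (k + 1) id"
  shows "fp n \<pi> \<le> k"
proof -
  have "involution_word n \<pi> \<in> ballot_words k n"
    using assms involution_word_bij unfolding bij_betw_def by blast
  then have "odd_letters (involution_word n \<pi>) \<subseteq> {1..k}" by (rule odd_letters_subset)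
  then have "card (odd_letters (involution_word n \<pi>)) \<le> card {1..k}" by (intro card_mono) auto
  moreover have "fp n \<pi> = card (odd_letters (involution_word n \<pi>))"
    using assms by (intro fp_involution_word) (auto simp: avoiding_involutions_def)
  ultimately show ?thesis by simp
qed

lemma sum_fp:
  fixes f :: "nat \<Rightarrow> real"
  shows "(\<Sum>\<pi> | \<pi> \<in> avoiding_involutions n (k + 1) id \<and> fp n \<pi> \<in> J. f (fp n \<pi>)) =
           (\<Sum>j\<in>{..k} \<inter> J. f j * card {w\<in>ballot_words k n. card (odd_letters w) = j})"
proof -
  let ?B = "{\<pi>\<in>avoiding_involutions n (k + 1) id. fp n \<pi> \<in> J}"
  have fin: "finite ?B" using finite_avoiding_involutions by simp
  have "(\<Sum>\<pi>\<in>?B. f (fp n \<pi>)) = (\<Sum>j\<in>{..k} \<inter> J. \<Sum>\<pi> | \<pi> \<in> ?B \<and> fp n \<pi> = j. f (fp n \<pi>))"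
    by (rule sum.group[symmetric]) (use fin fp_le in auto)
  also have "\<dots> = (\<Sum>j\<in>{..k} \<inter> J. f j * card {w\<in>ballot_words k n. card (odd_letters w) = j})"
  proof (rule sum.cong[OF refl])
    fix j assume j: "j \<in> {..k} \<inter> J"
    have "{\<pi>. \<pi> \<in> ?B \<and> fp n \<pi> = j} = {\<pi>\<in>avoiding_involutions n (k + 1) id. fp n \<pi> = j}"
      using j by auto
    then show "(\<Sum>\<pi> | \<pi> \<in> ?B \<and> fp n \<pi> = j. f (fp n \<pi>)) =
        f j * card {w\<in>ballot_words k n. card (odd_letters w) = j}"
      by (simp add: card_involutions_fp[simplified] mult.commute)
  qed
  finally show ?thesis .
qed

text \<open>
  The total weight \<open>q ^ fp \<pi>\<close> of the avoiding involutions whose number of fixed points lies in \<open>J\<close>.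
\<close>

definition fp_weight :: "nat \<Rightarrow> real \<Rightarrow> nat \<Rightarrow> nat set \<Rightarrow> real" where
  "fp_weight k q n J =
     (\<Sum>j\<in>{..k} \<inter> J. q ^ j * card {w\<in>ballot_words k n. card (odd_letters w) = j})"

lemma measure_fp:
  assumes "q > 0"
  shows "measure (involution_measure q n (k + 1) id)
           {\<pi>\<in>avoiding_involutions n (k + 1) id. fp n \<pi> \<in> J} = fp_weight k q n J / fp_weight k q n UNIV"
proof -
  let ?A = "avoiding_involutions n (k + 1) id"
  define Z where "Z = (\<Sum>\<tau>\<in>?A. q ^ fp n \<tau>)"
  have Z: "Z = fp_weight k q n UNIV"
    using sum_fp[where n = n and k = k and f = "\<lambda>j. q ^ j" and J = UNIV] by (simp add: Z_def fp_weight_def)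
  have Z0: "Z \<ge> 0" unfolding Z_def using assms by (intro sum_nonneg) auto
  have "emeasure (involution_measure q n (k + 1) id) {\<pi>\<in>?A. fp n \<pi> \<in> J} =
      (\<Sum>\<pi> | \<pi> \<in> ?A \<and> fp n \<pi> \<in> J. ennreal (q ^ fp n \<pi> / Z))"
    unfolding involution_measure_def Z_def
    by (rule emeasure_point_measure_finite) (use finite_avoiding_involutions in auto)
  also have "\<dots> = ennreal (\<Sum>\<pi> | \<pi> \<in> ?A \<and> fp n \<pi> \<in> J. q ^ fp n \<pi> / Z)"
    using assms Z0 by (intro sum_ennreal) auto
  finally have "measure (involution_measure q n (k + 1) id) {\<pi>\<in>?A. fp n \<pi> \<in> J} =
      (\<Sum>\<pi> | \<pi> \<in> ?A \<and> fp n \<pi> \<in> J. q ^ fp n \<pi> / Z)"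
    unfolding measure_def using assms Z0 by (simp add: sum_nonneg)
  also have "\<dots> = fp_weight k q n J / Z"
    using sum_fp[where n = n and k = k and f = "\<lambda>j. q ^ j / Z" and J = J]
    by (simp add: fp_weight_def sum_divide_distrib)
  finally show ?thesis by (simp add: Z)
qed

lemma cdf_fp:
  assumes "q > 0"
    and meas: "\<rho> \<in> measurable M (involution_measure q n (k + 1) id)"
    and dist: "distr M (involution_measure q n (k + 1) id) \<rho> = involution_measure q n (k + 1) id"
  shows "cdf (distr M borel (\<lambda>\<omega>. real (fp n (\<rho> \<omega>)))) x =
           fp_weight k q n {j. real j \<le> x} / fp_weight k q n UNIV"
proof -
  let ?I = "involution_measure q n (k + 1) id" and ?A = "avoiding_involutions n (k + 1) id"
  have space: "space ?I = ?A" by (simp add: involution_measure_def space_point_measure)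
  have h: "(\<lambda>\<pi>. real (fp n \<pi>)) \<in> measurable ?I borel" by (simp add: involution_measure_def)
  have "distr M borel (\<lambda>\<omega>. real (fp n (\<rho> \<omega>))) = distr (distr M ?I \<rho>) borel (\<lambda>\<pi>. real (fp n \<pi>))"
    using distr_distr[OF h meas] by (simp add: comp_def)
  then have "cdf (distr M borel (\<lambda>\<omega>. real (fp n (\<rho> \<omega>)))) x = measure (distr ?I borel (\<lambda>\<pi>. real (fp n \<pi>))) {..x}"
    unfolding dist by (simp add: cdf_def2)
  also have "\<dots> = measure ?I {\<pi>\<in>?A. fp n \<pi> \<in> {j. real j \<le> x}}"
  proof -
    have "(\<lambda>\<pi>. real (fp n \<pi>)) -` {..x} \<inter> space ?I = {\<pi>\<in>?A. fp n \<pi> \<in> {j. real j \<le> x}}"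
      unfolding space by auto
    then show ?thesis using measure_distr[OF h, of "{..x}"] by simp
  qed
  also have "\<dots> = fp_weight k q n {j. real j \<le> x} / fp_weight k q n UNIV"
    by (rule measure_fp[OF assms(1)])
  finally show ?thesis .
qed

lemma fp_weight_limit:
  assumes "k \<ge> 1"
    and r: "filterlim r sequentially sequentially"
    and P: "eventually (\<lambda>n. \<forall>j. even (j + r n) \<longleftrightarrow> j \<in> P) sequentially"
  shows "(\<lambda>n. fp_weight k q (r n) J / card (ballot_words k (r n)))
           \<longlonglongrightarrow> (\<Sum>j\<in>{..k} \<inter> J \<inter> P. q ^ j * (k choose j)) * 2 / 2 ^ k"
proof -
  let ?c = "\<lambda>n j. real (card {w\<in>ballot_words k n. card (odd_letters w) = j}) / card (ballot_words k n)"
  have lim: "(\<lambda>n. ?c (r n) j) \<longlonglongrightarrow> (if j \<in> P then real (k choose j) * 2 / 2 ^ k else 0)" for j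
  proof -
    have "(\<lambda>n. ?c (r n) j - (k choose j) * (1 + (- 1) ^ (j + r n)) / 2 ^ k) \<longlonglongrightarrow> 0"
      using filterlim_compose[OF odd_letter_count_limit[OF assms(1), of j] r] .
    then have "(\<lambda>n. ?c (r n) j - (if j \<in> P then real (k choose j) * 2 / 2 ^ k else 0)) \<longlonglongrightarrow> 0"
    proof (rule Lim_transform_eventually)
      show "eventually (\<lambda>n. ?c (r n) j - (k choose j) * (1 + (- 1) ^ (j + r n)) / 2 ^ k =
          ?c (r n) j - (if j \<in> P then real (k choose j) * 2 / 2 ^ k else 0)) sequentially"
        using P
      proof eventually_elim
        case (elim n)
        then have "(- 1 :: real) ^ (j + r n) = (if j \<in> P then 1 else - 1)"
          by (cases "j \<in> P") (auto simp del: power_add)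
        then show ?case by simp
      qed
    qed
    then show ?thesis by (rule LIM_zero_cancel)
  qed
  have eq: "fp_weight k q n J / card (ballot_words k n) = (\<Sum>j\<in>{..k} \<inter> J. q ^ j * ?c n j)" for n
    by (simp add: fp_weight_def sum_divide_distrib)
  have "(\<lambda>n. \<Sum>j\<in>{..k} \<inter> J. q ^ j * ?c (r n) j) \<longlonglongrightarrow>
      (\<Sum>j\<in>{..k} \<inter> J. q ^ j * (if j \<in> P then real (k choose j) * 2 / 2 ^ k else 0))"
    by (intro tendsto_sum tendsto_mult tendsto_const lim)
  also have "(\<Sum>j\<in>{..k} \<inter> J. q ^ j * (if j \<in> P then real (k choose j) * 2 / 2 ^ k else 0)) =
      (\<Sum>j\<in>{..k} \<inter> J \<inter> P. q ^ j * (real (k choose j) * 2 / 2 ^ k))"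
    by (rule sum.mono_neutral_cong_right) auto
  also have "\<dots> = (\<Sum>j\<in>{..k} \<inter> J \<inter> P. q ^ j * (k choose j)) * 2 / 2 ^ k"
    by (simp add: sum_distrib_right sum_divide_distrib mult.assoc)
  finally show ?thesis by (simp only: eq)
qed

lemma cdf_conditioned_binomial:
  assumes "q > 0" and ne: "{..k} \<inter> P \<noteq> {}"
  shows "cdf (distr (measure_pmf (cond_pmf (binomial_pmf k (q / (1 + q))) P)) borel real) x =
           (\<Sum>j\<in>{..k} \<inter> {j. real j \<le> x} \<inter> P. q ^ j * (k choose j)) /
           (\<Sum>j\<in>{..k} \<inter> P. q ^ j * (k choose j))"
proof -
  let ?b = "binomial_pmf k (q / (1 + q))"
  have p: "0 < q / (1 + q)" "q / (1 + q) < 1" "0 \<le> q / (1 + q)" "q / (1 + q) \<le> 1" using assms(1) by simp_all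
  have setb: "set_pmf ?b = {..k}" using p by simp
  have pmf: "pmf ?b j = q ^ j * (k choose j) / (1 + q) ^ k" if "j \<le> k" for j
  proof -
    have "1 - q / (1 + q) = 1 / (1 + q)" using assms(1) by (simp add: field_simps)
    then have "pmf ?b j = (k choose j) * (q / (1 + q)) ^ j * (1 / (1 + q)) ^ (k - j)" using p by simp
    also have "\<dots> = (k choose j) * q ^ j / ((1 + q) ^ j * (1 + q) ^ (k - j))" by (simp add: power_divide)
    also have "(1 + q) ^ j * (1 + q) ^ (k - j) = (1 + q) ^ k" using that by (simp flip: power_add)
    finally show ?thesis by simp
  qed
  have meas: "measure ?b X = (\<Sum>j\<in>{..k} \<inter> X. q ^ j * (k choose j)) / (1 + q) ^ k" for X
  proof -
    have "measure ?b X = measure ?b ({..k} \<inter> X)"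
      using measure_Int_set_pmf[of ?b X] setb by (simp add: Int_commute)
    also have "\<dots> = (\<Sum>j\<in>{..k} \<inter> X. pmf ?b j)" by (rule measure_measure_pmf_finite) simp
    also have "\<dots> = (\<Sum>j\<in>{..k} \<inter> X. q ^ j * (k choose j) / (1 + q) ^ k)" by (rule sum.cong) (auto simp: pmf)
    finally show ?thesis by (simp add: sum_divide_distrib)
  qed
  have ne': "set_pmf ?b \<inter> P \<noteq> {}" using ne setb by simp
  have "cdf (distr (measure_pmf (cond_pmf ?b P)) borel real) x = measure (cond_pmf ?b P) {j. real j \<le> x}"
    by (simp add: cdf_def2 measure_distr vimage_def)
  also have "\<dots> = measure (cond_pmf ?b P) ({..k} \<inter> {j. real j \<le> x} \<inter> P)"
    using measure_Int_set_pmf[of "cond_pmf ?b P" "{j. real j \<le> x}"] set_cond_pmf[OF ne'] setb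
    by (simp add: Int_ac)
  also have "\<dots> = (\<Sum>j\<in>{..k} \<inter> {j. real j \<le> x} \<inter> P. pmf (cond_pmf ?b P) j)"
    by (rule measure_measure_pmf_finite) simp
  also have "\<dots> = (\<Sum>j\<in>{..k} \<inter> {j. real j \<le> x} \<inter> P. pmf ?b j / measure ?b P)"
    by (rule sum.cong) (auto simp: pmf_cond[OF ne'])
  also have "\<dots> = measure ?b ({..k} \<inter> {j. real j \<le> x} \<inter> P) / measure ?b P"
    by (simp add: measure_measure_pmf_finite sum_divide_distrib)
  also have "\<dots> = (\<Sum>j\<in>{..k} \<inter> {j. real j \<le> x} \<inter> P. q ^ j * (k choose j)) /
           (\<Sum>j\<in>{..k} \<inter> P. q ^ j * (k choose j))"
    using assms(1) by (simp add: meas Int_assoc[symmetric])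
  finally show ?thesis .
qed

text \<open>
  Both halves of the theorem at once: \<open>r\<close> runs through lengths of a fixed parity, and \<open>P\<close> is the set of
  numbers of that parity.
\<close>

theorem fp_weak_limit:
  fixes M :: "nat \<Rightarrow> 'w measure" and \<rho> :: "nat \<Rightarrow> 'w \<Rightarrow> nat \<Rightarrow> nat"
  assumes k: "k \<ge> 1" and q: "q > 0"
    and meas: "\<And>n. n \<ge> 1 \<Longrightarrow> \<rho> n \<in> measurable (M n) (involution_measure q n (k + 1) id)"
    and dist: "\<And>n. n \<ge> 1 \<Longrightarrow>
           distr (M n) (involution_measure q n (k + 1) id) (\<rho> n) = involution_measure q n (k + 1) id"
    and r: "filterlim r sequentially sequentially"
    and P: "eventually (\<lambda>n. \<forall>j. even (j + r n) \<longleftrightarrow> j \<in> P) sequentially"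
  shows "weak_conv_m (\<lambda>n. distr (M (r n)) borel (\<lambda>\<omega>. real (fp (r n) (\<rho> (r n) \<omega>))))
           (distr (measure_pmf (cond_pmf (binomial_pmf k (q / (1 + q))) P)) borel real)"
  unfolding weak_conv_m_def weak_conv_def
proof (intro allI impI)
  fix x
  let ?T = "\<lambda>n. real (card (ballot_words k n))"
  let ?S = "\<lambda>J. (\<Sum>j\<in>{..k} \<inter> J \<inter> P. q ^ j * real (k choose j))"
  obtain n where n: "\<And>j. even (j + r n) \<longleftrightarrow> j \<in> P"
    using eventually_happens[OF P] by auto
  have "0 \<in> P \<or> 1 \<in> P" using n[of 0] n[of 1] by auto
  then have ne: "{..k} \<inter> P \<noteq> {}" using k by auto
  have S0: "?S UNIV > 0"
    by (rule sum_pos) (use ne q in auto)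
  have "(\<lambda>n. (fp_weight k q (r n) {j. real j \<le> x} / ?T (r n)) / (fp_weight k q (r n) UNIV / ?T (r n)))
      \<longlonglongrightarrow> (?S {j. real j \<le> x} * 2 / 2 ^ k) / (?S UNIV * 2 / 2 ^ k)"
    by (intro tendsto_divide fp_weight_limit[OF k r P]) (use S0 in auto)
  also have "(?S {j. real j \<le> x} * 2 / 2 ^ k) / (?S UNIV * 2 / 2 ^ k) = ?S {j. real j \<le> x} / ?S UNIV"
    by simp
  also have "\<dots> = cdf (distr (measure_pmf (cond_pmf (binomial_pmf k (q / (1 + q))) P)) borel real) x"
    by (simp add: cdf_conditioned_binomial[OF q ne])
  finally have lim: "(\<lambda>n. (fp_weight k q (r n) {j. real j \<le> x} / ?T (r n)) / (fp_weight k q (r n) UNIV / ?T (r n)))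
      \<longlonglongrightarrow> cdf (distr (measure_pmf (cond_pmf (binomial_pmf k (q / (1 + q))) P)) borel real) x" .
  have "eventually (\<lambda>n. 1 \<le> r n) sequentially" using r by (simp add: filterlim_at_top)
  then have "eventually (\<lambda>n.
        (fp_weight k q (r n) {j. real j \<le> x} / ?T (r n)) / (fp_weight k q (r n) UNIV / ?T (r n)) =
        cdf (distr (M (r n)) borel (\<lambda>\<omega>. real (fp (r n) (\<rho> (r n) \<omega>)))) x) sequentially"
  proof eventually_elim
    case (elim n)
    have "?T (r n) \<noteq> 0" using card_ballot_words_pos[OF k, of "r n"] by linarith
    then show ?case using cdf_fp[OF q meas[OF elim] dist[OF elim], of x] by simp
  qed
  then show "(\<lambda>n. cdf (distr (M (r n)) borel (\<lambda>\<omega>. real (fp (r n) (\<rho> (r n) \<omega>)))) x)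
      \<longlonglongrightarrow> cdf (distr (measure_pmf (cond_pmf (binomial_pmf k (q / (1 + q))) P)) borel real) x"
    by (rule Lim_transform_eventually[OF lim])
qed

theorem theorem1:
  fixes k :: nat and q :: real
    and M :: "nat \<Rightarrow> 'w measure" and \<rho> :: "nat \<Rightarrow> 'w \<Rightarrow> nat \<Rightarrow> nat"
  assumes "k \<ge> 1" and "q > 0"
    and "\<And>n. n \<ge> 1 \<Longrightarrow> prob_space (M n)"
    and "\<And>n. n \<ge> 1 \<Longrightarrow> \<rho> n \<in> measurable (M n) (involution_measure q n (k + 1) id)"
    and "\<And>n. n \<ge> 1 \<Longrightarrow>
           distr (M n) (involution_measure q n (k + 1) id) (\<rho> n) = involution_measure q n (k + 1) id"
  shows "weak_conv_m (\<lambda>n. distr (M (2 * n)) borel (\<lambda>\<omega>. real (fp (2 * n) (\<rho> (2 * n) \<omega>))))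
           (distr (measure_pmf (cond_pmf (binomial_pmf k (q / (1 + q))) {x. even x})) borel real)
       \<and> weak_conv_m (\<lambda>n. distr (M (2 * n - 1)) borel (\<lambda>\<omega>. real (fp (2 * n - 1) (\<rho> (2 * n - 1) \<omega>))))
           (distr (measure_pmf (cond_pmf (binomial_pmf k (q / (1 + q))) {x. odd x})) borel real)"
proof
  show "weak_conv_m (\<lambda>n. distr (M (2 * n)) borel (\<lambda>\<omega>. real (fp (2 * n) (\<rho> (2 * n) \<omega>))))
           (distr (measure_pmf (cond_pmf (binomial_pmf k (q / (1 + q))) {x. even x})) borel real)"
  proof (rule fp_weak_limit[where r = "\<lambda>n. 2 * n", OF assms(1,2,4,5)])
    show "filterlim (\<lambda>n::nat. 2 * n) sequentially sequentially"
      by (intro filterlim_subseq strict_monoI) simp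
  qed simp_all
  show "weak_conv_m (\<lambda>n. distr (M (2 * n - 1)) borel (\<lambda>\<omega>. real (fp (2 * n - 1) (\<rho> (2 * n - 1) \<omega>))))
           (distr (measure_pmf (cond_pmf (binomial_pmf k (q / (1 + q))) {x. odd x})) borel real)"
  proof (rule fp_weak_limit[where r = "\<lambda>n. 2 * n - 1", OF assms(1,2,4,5)])
    show "filterlim (\<lambda>n::nat. 2 * n - 1) sequentially sequentially"
      unfolding filterlim_at_top
    proof
      fix Z
      show "eventually (\<lambda>n. Z \<le> 2 * n - 1) sequentially"
        by (rule eventually_sequentiallyI[of "Suc Z"]) simp
    qed
    show "eventually (\<lambda>n. \<forall>j. even (j + (2 * n - 1)) \<longleftrightarrow> j \<in> {x. odd x}) sequentially"
      by (rule eventually_sequentiallyI[of 1]) auto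
  qed
qed

end
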